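(* Let $F:\mathcal{P}(\mathcal{X})\times\mathcal{P}(\mathcal{Y})\to\mathbb{R}$ and $\sigma>0$. Assume: (i) (Bounded first-order flat derivatives) $F$ admits first-order flat derivatives with respect to both $\nu$ and $\mu$, and there exist constants $C_\nu,C_\mu>0$ such that for all $(\nu,\mu)\in\mathcal{P}(\mathcal{X})\times\mathcal{P}(\mathcal{Y})$ and all $(x,y)\in\mathcal{X}\times\mathcal{Y}$, $\left|\frac{\delta F}{\delta\nu}(\nu,\mu,x)\right|\le C_\nu$ and $\left|\frac{\delta F}{\delta\mu}(\nu,\mu,y)\right|\le C_\mu$. (ii) (Bounded second-order flat derivatives) $F$ admits second-order flat derivatives, and there exist constants $C_{\nu,\nu},C_{\mu,\mu},C_{\nu,\mu},C_{\mu,\nu}>0$ such that for all $(\nu,\mu)\in\mathcal{P}(\mathcal{X})\times\mathcal{P}(\mathcal{Y})$ and all $(x,y),(x',y')\in\mathcal{X}\times\mathcal{Y}$, $\left|\frac{\delta^2F}{\delta\nu^2}(\nu,\mu,x,x')\right|\le C_{\nu,\nu}$, $\left|\frac{\delta^2F}{\delta\mu^2}(\nu,\mu,y,y')\right|\le C_{\mu,\mu}$, $\left|\frac{\delta^2F}{\delta\nu\delta\mu}(\nu,\mu,y,x)\right|\le C_{\nu,\mu}$, $\left|\frac{\delta^2F}{\delta\mu\delta\nu}(\nu,\mu,x,y)\right|\le C_{\mu,\nu}$. Let $(\nu_0,\mu_0)\in\mathcal{P}_{\text{ac}}(\mathcal{X})\times\mathcal{P}_{\text{ac}}(\mathcal{Y})$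 be absolutely continuous with respect to $\pi$ and $\rho$, respectively, and such that there exist constants $R_\nu,R_\mu>1$ with $$\sup_{x\in\mathcal{X}}\frac{\nu_0(x)}{\pi(x)}\le R_\nu,\qquad \sup_{y\in\mathcal{Y}}\frac{\mu_0(y)}{\rho(y)}\le R_\mu .$$ Then there exists a unique pair of flows $(\nu_t,\mu_t)_{t\in[0,\infty)}$ in $\mathcal{P}_{\text{ac}}(\mathcal{X})\times\mathcal{P}_{\text{ac}}(\mathcal{Y})$, continuous and differentiable in time, with initial condition $(\nu_0,\mu_0)$, satisfying $$\begin{cases}\partial_t\nu_t(x)=-a(\nu_t,\mu_t,x)\,\nu_t(x),\\ \partial_t\mu_t(y)=b(\nu_t,\mu_t,y)\,\mu_t(y),\end{cases}$$ where $a(\nu,\mu,x)=\frac{\delta F}{\delta\nu}(\nu,\mu,x)+\frac{\sigma^2}{2}\log\left(\frac{\nu(x)}{\pi(x)}\right)-\frac{\sigma^2}{2}\mathrm{D_{KL}}(\nu|\pi)$ and $b(\nu,\mu,y)=\frac{\delta F}{\delta\mu}(\nu,\mu,y)-\frac{\sigma^2}{2}\log\left(\frac{\mu(y)}{\rho(y)}\right)+\frac{\sigma^2}{2}\mathrm{D_{KL}}(\mu|\rho)$. Moreover, for all $t>0$, $$\mathrm{D_{KL}}(\nu_t|\pi)\le 2\log R_\nu+\frac{4}{\sigma^2}C_\nu,\qquad \mathrm{D_{KL}}(\mu_t|\rho)\le 2\log R_\mu+\frac{4}{\sigma^2}C_\mu,$$ and there exist constants $R_{1,\nu},R_{1,\mu}>1$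 such that for all $t>0$, $$\sup_{x\in\mathcal{X}}\frac{\nu_t(x)}{\pi(x)}\le R_{1,\nu},\qquad \sup_{y\in\mathcal{Y}}\frac{\mu_t(y)}{\rho(y)}\le R_{1,\mu}.$$ Additionally, if there exist constants $r_\nu,r_\mu>0$ with $\inf_{x\in\mathcal{X}}\frac{\nu_0(x)}{\pi(x)}\ge r_\nu$ and $\inf_{y\in\mathcal{Y}}\frac{\mu_0(y)}{\rho(y)}\ge r_\mu$, then there exist constants $r_{1,\nu},r_{1,\mu}>0$ such that for all $t>0$, $$\inf_{x\in\mathcal{X}}\frac{\nu_t(x)}{\pi(x)}\ge r_{1,\nu},\qquad \inf_{y\in\mathcal{Y}}\frac{\mu_t(y)}{\rho(y)}\ge r_{1,\mu}.$$
   Context: Setting. $\mathcal{X},\mathcal{Y}\subseteq\mathbb{R}^d$. $\mathcal{P}(\mathcal{Z})$ is the set of probability measures on $\mathcal{Z}$ and $\mathcal{P}_{\text{ac}}(\mathcal{Z})$ the subset of those absolutely continuous with respect to Lebesgue measure; the same symbol denotes such a measure and its density. $\pi(\mathrm{d}x)\propto e^{-U^\pi(x)}\mathrm{d}x\in\mathcal{P}_{\text{ac}}(\mathcal{X})$ and $\rho(\mathrm{d}y)\propto e^{-U^\rho(y)}\mathrm{d}y\in\mathcal{P}_{\text{ac}}(\mathcal{Y})$ are fixed reference probability measures, with $U^\pi:\mathcal{X}\to\mathbb{R}$, $U^\rho:\mathcal{Y}\to\mathbb{R}$ measurable. $\mathrm{D_{KL}}(\nu|\pi)=\int_{\mathcal{X}}\log\left(\frac{\nu(x)}{\pi(x)}\right)\nu(x)\mathrm{d}x$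 if $\nu$ is absolutely continuous with respect to $\pi$, and $+\infty$ otherwise; similarly $\mathrm{D_{KL}}(\mu|\rho)$. Flat derivative. For $\mathcal{M}\subseteq\mathbb{R}^d$, a function $G:\mathcal{P}(\mathcal{M})\to\mathbb{R}$ admits a first-order flat derivative if there is a function $\frac{\delta G}{\delta m}:\mathcal{P}(\mathcal{M})\times\mathcal{M}\to\mathbb{R}$, jointly continuous (with the weak topology on $\mathcal{P}(\mathcal{M})$), bounded in $x$ for each fixed $m$, such that for all $m,m'\in\mathcal{P}(\mathcal{M})$, $G(m')-G(m)=\int_0^1\int_{\mathcal{M}}\frac{\delta G}{\delta m}(m+\varepsilon(m'-m),x)(m'-m)(\mathrm{d}x)\mathrm{d}\varepsilon$. It is unique up to an additive constant (depending on $m$), fixed by the convention $\int_{\mathcal{M}}\frac{\delta G}{\delta m}(m,x)m(\mathrm{d}x)=0$. For $F(\nu,\mu)$, $\frac{\delta F}{\delta\nu}(\nu,\mu,x)$ and $\frac{\delta F}{\delta\mu}(\nu,\mu,y)$ are the flat derivatives in one variable with the other fixed. Second-order flat derivatives are flat derivatives of first-order ones at a fixed point: $\frac{\delta^2F}{\delta\nu^2}(\nu,\mu,x,x')$ is the flat derivative in $\nu$ (evaluated at $x'$) of $\nu\mapsto\frac{\delta F}{\delta\nu}(\nu,\mu,x)$; $\frac{\delta^2F}{\delta\mu\delta\nu}(\nu,\mu,x,y)$ is the flat derivative in $\mu$ (at $y$) of $\mu\mapsto\frac{\delta F}{\delta\nu}(\nu,\mu,x)$; $\frac{\delta^2F}{\delta\nu\delta\mu}(\nu,\mu,y,x)$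 is the flat derivative in $\nu$ (at $x$) of $\nu\mapsto\frac{\delta F}{\delta\mu}(\nu,\mu,y)$; $\frac{\delta^2F}{\delta\mu^2}(\nu,\mu,y,y')$ is defined analogously. The system of equations is understood pointwise for the densities, as a classical ordinary differential equation in $t$. *)

theory Defs
  imports "HOL-Probability.Probability"
begin

section \<open>Probability measures on a subset of Euclidean space\<close>

definition prob_measures :: "'a::euclidean_space set \<Rightarrow> 'a measure set" where
  "prob_measures Z = {m. prob_space m \<and> sets m = sets (restrict_space borel Z)}"

definition prob_measures_ac :: "'a::euclidean_space set \<Rightarrow> 'a measure set" where
  "prob_measures_ac Z =
     {m \<in> prob_measures Z. absolutely_continuous (restrict_space lborel Z) m}"

definition measure_of_density :: "'a::euclidean_space set \<Rightarrow> ('a \<Rightarrow> real) \<Rightarrow> 'a measure" where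
  "measure_of_density Z p = density (restrict_space lborel Z) (\<lambda>x. ennreal (p x))"

text \<open>
  Elements of \<open>prob_measures_ac Z\<close> are handled through a pointwise chosen density, because the
  flow below is a pointwise equation for densities. Non-negativity is required at every point of
  \<open>Z\<close>. Values outside \<open>Z\<close> are irrelevant.
\<close>

definition ac_density :: "'a::euclidean_space set \<Rightarrow> ('a \<Rightarrow> real) \<Rightarrow> bool" where
  "ac_density Z p \<longleftrightarrow>
     p \<in> borel_measurable (restrict_space borel Z) \<and> (\<forall>x\<in>Z. 0 \<le> p x) \<and>
     measure_of_density Z p \<in> prob_measures_ac Z"

text \<open>
  For probability measures the negative part of \<open>log (dN/dM)\<close> is always \<open>N\<close>-integrable, so the
  integral defining the relative entropy exists in \<open>(-\<infinity>, \<infinity>]\<close> and equals \<open>\<infinity>\<close> exactly when the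
  integrand is not integrable. The library's real-valued \<open>KL_divergence\<close> would be \<open>0\<close> in that
  case. Note also that its first measure argument is the reference measure.
\<close>

definition KL :: "'a measure \<Rightarrow> 'a measure \<Rightarrow> ereal" where
  "KL N M =
     (if absolutely_continuous M N \<and> integrable N (entropy_density (exp 1) M N)
      then ereal (KL_divergence (exp 1) M N) else \<infinity>)"

section \<open>Flat derivatives\<close>

definition weak_topology :: "'a::euclidean_space set \<Rightarrow> 'a measure topology" where
  "weak_topology Z = topology_generated_by
     {{m \<in> prob_measures Z. (LINT x|m. f x) \<in> U} |f U.
        continuous_on Z f \<and> bounded (f ` Z) \<and> open (U :: real set)}"

text \<open>The convex combination \<open>m + \<epsilon> (m' - m)\<close>, for \<open>0 \<le> \<epsilon> \<le> 1\<close>.\<close>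

definition mixture :: "real \<Rightarrow> 'a measure \<Rightarrow> 'a measure \<Rightarrow> 'a measure" where
  "mixture \<epsilon> m m' = measure_of (space m) (sets m)
     (\<lambda>A. ennreal (1 - \<epsilon>) * emeasure m A + ennreal \<epsilon> * emeasure m' A)"

text \<open>
  \<open>D\<close> is the first-order flat derivative of \<open>G\<close> on the probability measures on \<open>Z\<close>. Integration
  against the signed measure \<open>m' - m\<close> is written as a difference of two integrals. The last
  conjunct is the convention that fixes the additive constant.
\<close>

definition has_flat_derivative ::
  "'a::euclidean_space set \<Rightarrow> ('a measure \<Rightarrow> real) \<Rightarrow> ('a measure \<Rightarrow> 'a \<Rightarrow> real) \<Rightarrow> bool" where
  "has_flat_derivative Z G D \<longleftrightarrow>
     continuous_map (prod_topology (weak_topology Z) (top_of_set Z)) euclideanreal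
       (\<lambda>(m, x). D m x) \<and>
     (\<forall>m\<in>prob_measures Z. bounded (D m ` Z)) \<and>
     (\<forall>m\<in>prob_measures Z. \<forall>m'\<in>prob_measures Z.
        let I = (\<lambda>\<epsilon>. (LINT x|m'. D (mixture \<epsilon> m m') x) - (LINT x|m. D (mixture \<epsilon> m m') x))
        in set_integrable lborel {0..1} I \<and> G m' - G m = (LINT \<epsilon>:{0..1}|lborel. I \<epsilon>)) \<and>
     (\<forall>m\<in>prob_measures Z. (LINT x|m. D m x) = 0)"

section \<open>The Fisher--Rao flow\<close>

text \<open>
  The arguments \<open>n\<close>, \<open>m\<close>, \<open>p\<close>, \<open>r\<close> are densities; \<open>DF\<close> is the flat derivative of \<open>F\<close> in the
  respective variable. Since \<open>ln 0 = 0\<close>, and the rates enter the equations only multiplied by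
  the density, \<open>0 * log 0\<close> is read as \<open>0\<close>. The relative entropy is converted to a real number
  here; \<open>is_flow\<close> requires it to be finite.
\<close>

definition rate_a ::
  "'a::euclidean_space set \<Rightarrow> 'b::euclidean_space set \<Rightarrow> real \<Rightarrow>
   ('a measure \<Rightarrow> 'b measure \<Rightarrow> 'a \<Rightarrow> real) \<Rightarrow> ('a \<Rightarrow> real) \<Rightarrow>
   ('a \<Rightarrow> real) \<Rightarrow> ('b \<Rightarrow> real) \<Rightarrow> 'a \<Rightarrow> real" where
  "rate_a X Y \<sigma> DF p n m x =
     DF (measure_of_density X n) (measure_of_density Y m) x
     + \<sigma>\<^sup>2 / 2 * ln (n x / p x)
     - \<sigma>\<^sup>2 / 2 * real_of_ereal (KL (measure_of_density X n) (measure_of_density X p))"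

definition rate_b ::
  "'a::euclidean_space set \<Rightarrow> 'b::euclidean_space set \<Rightarrow> real \<Rightarrow>
   ('a measure \<Rightarrow> 'b measure \<Rightarrow> 'b \<Rightarrow> real) \<Rightarrow> ('b \<Rightarrow> real) \<Rightarrow>
   ('a \<Rightarrow> real) \<Rightarrow> ('b \<Rightarrow> real) \<Rightarrow> 'b \<Rightarrow> real" where
  "rate_b X Y \<sigma> DF r n m y =
     DF (measure_of_density X n) (measure_of_density Y m) y
     - \<sigma>\<^sup>2 / 2 * ln (m y / r y)
     + \<sigma>\<^sup>2 / 2 * real_of_ereal (KL (measure_of_density Y m) (measure_of_density Y r))"

definition is_flow ::
  "'a::euclidean_space set \<Rightarrow> 'b::euclidean_space set \<Rightarrow> real \<Rightarrow>
   ('a measure \<Rightarrow> 'b measure \<Rightarrow> 'a \<Rightarrow> real) \<Rightarrow> ('a measure \<Rightarrow> 'b measure \<Rightarrow> 'b \<Rightarrow> real) \<Rightarrow>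
   ('a \<Rightarrow> real) \<Rightarrow> ('b \<Rightarrow> real) \<Rightarrow> ('a \<Rightarrow> real) \<Rightarrow> ('b \<Rightarrow> real) \<Rightarrow>
   (real \<Rightarrow> 'a \<Rightarrow> real) \<Rightarrow> (real \<Rightarrow> 'b \<Rightarrow> real) \<Rightarrow> bool" where
  "is_flow X Y \<sigma> D\<nu> D\<mu> p r n0 m0 n m \<longleftrightarrow>
     (\<forall>t\<ge>0. ac_density X (n t) \<and> ac_density Y (m t)) \<and>
     (\<forall>x\<in>X. n 0 x = n0 x) \<and> (\<forall>y\<in>Y. m 0 y = m0 y) \<and>
     (\<forall>t\<ge>0. KL (measure_of_density X (n t)) (measure_of_density X p) < \<infinity> \<and>
             KL (measure_of_density Y (m t)) (measure_of_density Y r) < \<infinity>) \<and>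
     (\<forall>x\<in>X. continuous_on {0..} (\<lambda>t. n t x)) \<and>
     (\<forall>y\<in>Y. continuous_on {0..} (\<lambda>t. m t y)) \<and>
     (\<forall>t\<ge>0. \<forall>x\<in>X. ((\<lambda>s. n s x) has_real_derivative
         - rate_a X Y \<sigma> D\<nu> p (n t) (m t) x * n t x) (at t within {0..})) \<and>
     (\<forall>t\<ge>0. \<forall>y\<in>Y. ((\<lambda>s. m s y) has_real_derivative
         rate_b X Y \<sigma> D\<mu> r (n t) (m t) y * m t y) (at t within {0..}))"

end

(*
  Let u = d nu / d pi be the relative density, c = sigma^2 / 2 and g = dF/dnu along the flow. The
  equation for ln u is linear up to a term that depends on time only, so u is a normalisation
  E_t / Z_t of the explicit tilt E_t = u_0^(e^(-ct)) exp (- int_0^t e^(-c(t-s)) g_s ds); the relative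
  entropy in the equation is exactly what the normalisation produces, because the integral of g
  against nu vanishes by convention. The factor e^(-ct) makes E_t, and hence u_t, bounded uniformly
  in time, which gives all the estimates. The mu-equation has the same form with g = - dF/dmu.

  A flow is therefore the same thing as a fixed point of g |-> (flat derivatives at the tilts of g).
  Bounded second-order derivatives make the flat derivatives Lipschitz in L^1, so this map is a
  contraction for the distance sup e^(-lt) |g - h| with l large. Working with the rates g rather than
  the densities makes completeness trivial: only pointwise limits occur.
*)
theory Submission
  imports Defs
begin

section \<open>Dependence of integrals on a parameter\<close>

text \<open>Uniqueness is where the obstacles lie. A competing flow comes with no bound on its
  density and no regularity in time of its relative entropy, and u ln u is not Lipschitz at 0
  although \<open>u0\<close> may vanish. The entropy term is therefore kept as an arbitrary function
  k(t) of which only k \<ge> 0 is used. Comparing two points makes k cancel, and unit mass then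
  fixes the one time-dependent factor left undetermined. Continuity in time of the rates along such
  a flow comes from Scheffe's lemma, as no dominating function is available.

  The constants all come from K = R exp (C / c): a tilt is at most K and its mass is at least 1 / K,
  so the density is at most \<open>K\<^sup>2\<close>. With c = \<open>\<sigma>\<^sup>2 / 2\<close>,
  the logarithm of \<open>K\<^sup>2\<close> is exactly the entropy bound of the theorem. The
  contraction constant comes from integrating the weight e^(lt), which gains 1 / l.\<close>

lemma L1_continuous_of_probability_densities:
  fixes f :: "real \<Rightarrow> 'a \<Rightarrow> real"
  assumes int: "\<And>t. t \<in> S \<Longrightarrow> integrable M (f t)"
    and nonneg: "\<And>t x. t \<in> S \<Longrightarrow> x \<in> space M \<Longrightarrow> 0 \<le> f t x"
    and one: "\<And>t. t \<in> S \<Longrightarrow> (LINT x|M. f t x) = 1"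
    and cont: "\<And>x. x \<in> space M \<Longrightarrow> continuous_on S (\<lambda>t. f t x)"
    and t: "t \<in> S"
  shows "((\<lambda>s. LINT x|M. \<bar>f s x - f t x\<bar>) \<longlongrightarrow> 0) (at t within S)"
  unfolding tendsto_at_iff_sequentially
proof (intro allI impI)
  fix X assume X: "\<forall>i. X i \<in> S - {t}" "X \<longlonglongrightarrow> t"
  then have XS: "X i \<in> S" for i by auto
  \<comment> \<open>All \<open>f s\<close> have the same mass, so Scheffe's lemma upgrades pointwise
    convergence to convergence in mean.\<close>
  have "(\<lambda>n. \<integral>\<^sup>+ x. norm (f (X n) x - f t x) \<partial>M) \<longlonglongrightarrow> 0"
  proof (rule Scheffe_lemma2)
    show "AE x in M. (\<lambda>n. f (X n) x) \<longlonglongrightarrow> f t x"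
      using continuous_on_tendsto_compose[OF cont X(2) t] XS by (auto intro!: AE_I2)
    have nn: "(\<integral>\<^sup>+ x. norm (f s x) \<partial>M) = 1" if "s \<in> S" for s
      using nn_integral_eq_integral[of M "\<lambda>x. norm (f s x)"] int[OF that] one[OF that] nonneg[OF that]
      by (simp cong: Bochner_Integration.integral_cong)
    show "(\<integral>\<^sup>+ x. norm (f (X n) x) \<partial>M) \<le> (\<integral>\<^sup>+ x. norm (f t x) \<partial>M)" for n
      by (simp only: nn[OF XS] nn[OF t])
  qed (use int XS t in auto)
  moreover have "(\<integral>\<^sup>+ x. norm (f (X n) x - f t x) \<partial>M) = ennreal (LINT x|M. \<bar>f (X n) x - f t x\<bar>)" for n
    using int[OF XS, of n] int[OF t] by (simp add: nn_integral_eq_integral)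
  ultimately show "((\<lambda>s. LINT x|M. \<bar>f s x - f t x\<bar>) \<circ> X) \<longlonglongrightarrow> 0"
    by (simp add: o_def tendsto_ennreal_iff flip: ennreal_0)
qed

text \<open>By the mean value inequality on the convex set \<open>S\<close>, all difference
  quotients are bounded by \<open>B\<close>, which is integrable over a finite measure; dominated
  convergence does the rest. Working within \<open>S\<close> admits the one-sided derivative at time
  0.\<close>

lemma (in finite_measure) has_real_derivative_integral_of_bounded_derivative:
  fixes f f' :: "real \<Rightarrow> 'a \<Rightarrow> real"
  assumes S: "convex S" "t \<in> S"
    and int: "\<And>s. s \<in> S \<Longrightarrow> integrable M (f s)"
    and meas: "f' t \<in> borel_measurable M"
    and deriv: "\<And>s x. s \<in> S \<Longrightarrow> x \<in> space M \<Longrightarrow>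
      ((\<lambda>r. f r x) has_real_derivative f' s x) (at s within S)"
    and bound: "\<And>s x. s \<in> S \<Longrightarrow> x \<in> space M \<Longrightarrow> \<bar>f' s x\<bar> \<le> B"
  shows "((\<lambda>s. LINT x|M. f s x) has_real_derivative (LINT x|M. f' t x)) (at t within S)"
  unfolding has_field_derivative_iff tendsto_at_iff_sequentially
proof (intro allI impI)
  fix X assume X: "\<forall>i. X i \<in> S - {t}" "X \<longlonglongrightarrow> t"
  then have XS: "X i \<in> S" "X i \<noteq> t" for i by auto
  have "(\<lambda>i. LINT x|M. (f (X i) x - f t x) / (X i - t)) \<longlonglongrightarrow> (LINT x|M. f' t x)"
  proof (rule integral_dominated_convergence[where w = "\<lambda>_. B"])
    show "AE x in M. (\<lambda>i. (f (X i) x - f t x) / (X i - t)) \<longlonglongrightarrow> f' t x"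
    proof (rule AE_I2)
      fix x assume "x \<in> space M"
      from deriv[OF S(2) this] X show "(\<lambda>i. (f (X i) x - f t x) / (X i - t)) \<longlonglongrightarrow> f' t x"
        unfolding has_field_derivative_iff tendsto_at_iff_sequentially by (auto simp: o_def)
    qed
    show "AE x in M. norm ((f (X i) x - f t x) / (X i - t)) \<le> B" for i
    proof (rule AE_I2)
      fix x assume x: "x \<in> space M"
      have "norm (f (X i) x - f t x) \<le> B * norm (X i - t)"
        by (rule field_differentiable_bound[OF S(1)]) (use deriv bound x XS S(2) in auto)
      then show "norm ((f (X i) x - f t x) / (X i - t)) \<le> B"
        using XS(2)[of i] by (simp add: divide_le_eq)
    qed
    show "(\<lambda>x. (f (X i) x - f t x) / (X i - t)) \<in> borel_measurable M" for i
      using int[OF XS(1)[of i]] int[OF S(2)] by auto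
  qed (use meas in auto)
  then show "((\<lambda>s. ((LINT x|M. f s x) - (LINT x|M. f t x)) / (s - t)) \<circ> X)
      \<longlonglongrightarrow> (LINT x|M. f' t x)"
    using int XS S(2) by (simp add: o_def Bochner_Integration.integral_diff)
qed

text \<open>A Caratheodory argument: continuity in time and measurability in space give joint
  measurability, and measurability of the integral follows as in Fubini's theorem.\<close>

lemma measurable_integral_of_continuous_parameter:
  fixes f :: "real \<Rightarrow> 'a \<Rightarrow> real"
  assumes cont: "\<And>x. x \<in> space M \<Longrightarrow> continuous_on {0..} (\<lambda>s. f s x)"
    and meas: "\<And>s. 0 \<le> s \<Longrightarrow> f s \<in> borel_measurable M"
  shows "(\<lambda>x. integral {0..t} (\<lambda>s. f s x)) \<in> borel_measurable M"
proof -
  \<comment> \<open>Rounds time down to the grid of step 1 / (n + 1). The maximum with 0 keeps the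
    argument in the half-line on which \<open>f\<close> is continuous and measurable.\<close>
  define q where "q n s = real_of_int \<lfloor>real (Suc n) * max 0 s\<rfloor> / real (Suc n)" for n :: nat and s
  have q0: "0 \<le> q n s" for n s
    by (simp add: q_def)
  have q_lim: "(\<lambda>n. q n s) \<longlonglongrightarrow> max 0 s" for s
  proof (rule tendsto_sandwich)
    show "\<forall>\<^sub>F n in sequentially. max 0 s - 1 / real (Suc n) \<le> q n s"
    proof (rule always_eventually, rule allI)
      fix n
      have "real (Suc n) * max 0 s - 1 \<le> real_of_int \<lfloor>real (Suc n) * max 0 s\<rfloor>"
        by linarith
      then have "(real (Suc n) * max 0 s - 1) / real (Suc n) \<le> q n s"
        unfolding q_def by (rule divide_right_mono) simp
      then show "max 0 s - 1 / real (Suc n) \<le> q n s"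
        by (simp add: diff_divide_distrib)
    qed
    show "\<forall>\<^sub>F n in sequentially. q n s \<le> max 0 s"
    proof (rule always_eventually, rule allI)
      fix n
      have "real_of_int \<lfloor>real (Suc n) * max 0 s\<rfloor> \<le> real (Suc n) * max 0 s"
        by linarith
      then show "q n s \<le> max 0 s"
        unfolding q_def by (simp add: field_simps)
    qed
    show "(\<lambda>n. max 0 s - 1 / real (Suc n)) \<longlonglongrightarrow> max 0 s"
      by (rule tendsto_eq_intros tendsto_const LIMSEQ_Suc[OF lim_1_over_n])+ simp
  qed simp
  have joint: "(\<lambda>z. f (max 0 (snd z)) (fst z)) \<in> borel_measurable (M \<Otimes>\<^sub>M (lborel :: real measure))"
  proof (rule borel_measurable_LIMSEQ_real)
    fix z assume "z \<in> space (M \<Otimes>\<^sub>M (lborel :: real measure))"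
    then have "fst z \<in> space M" by (auto simp: space_pair_measure)
    from continuous_on_tendsto_compose[OF cont[OF this] q_lim]
    show "(\<lambda>n. f (q n (snd z)) (fst z)) \<longlonglongrightarrow> f (max 0 (snd z)) (fst z)"
      by (simp add: q0)
  next
    fix n
    \<comment> \<open>At rounded times only countably many functions \<open>f s\<close> occur,
      indexed by the integer floor.\<close>
    have "(\<lambda>z. (\<lambda>i z. f (max 0 (real_of_int i / real (Suc n))) (fst z))
              \<lfloor>real (Suc n) * max 0 (snd z)\<rfloor> z) \<in> borel_measurable (M \<Otimes>\<^sub>M (lborel :: real measure))"
    proof (rule measurable_compose_countable[where f = "\<lambda>i z. f (max 0 (real_of_int i / real (Suc n))) (fst z)"
          and g = "\<lambda>z. \<lfloor>real (Suc n) * max 0 (snd z)\<rfloor>"])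
      fix i :: int
      show "(\<lambda>z. f (max 0 (real_of_int i / real (Suc n))) (fst z)) \<in> borel_measurable (M \<Otimes>\<^sub>M (lborel :: real measure))"
        by (rule measurable_compose[OF measurable_fst meas]) simp
    qed measurable
    moreover have "max 0 (real_of_int \<lfloor>real (Suc n) * max 0 s\<rfloor> / real (Suc n)) = q n s" for s
      using q0[of n s] by (simp add: q_def)
    ultimately show "(\<lambda>z. f (q n (snd z)) (fst z)) \<in> borel_measurable (M \<Otimes>\<^sub>M (lborel :: real measure))"
      by simp
  qed
  have "(\<lambda>x. LINT s|lborel. indicator {0..t} s * f (max 0 s) x) \<in> borel_measurable M"
    using joint by (intro lborel.borel_measurable_lebesgue_integral) (simp add: split_beta)
  moreover have "(LINT s|lborel. indicator {0..t} s * f (max 0 s) x) = integral {0..t} (\<lambda>s. f s x)"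
    if x: "x \<in> space M" for x
  proof -
    have c: "continuous_on {0..t} (\<lambda>s. f s x)"
      by (rule continuous_on_subset[OF cont[OF x]]) auto
    have "(LINT s|lborel. indicator {0..t} s * f (max 0 s) x) = (LINT s:{0..t}|lborel. f s x)"
      unfolding set_lebesgue_integral_def
      by (rule Bochner_Integration.integral_cong) (auto simp: indicator_def)
    also have "\<dots> = integral {0..t} (\<lambda>s. f s x)"
      by (rule set_borel_integral_eq_integral(2)[OF borel_integrable_atLeastAtMost'[OF c]])
    finally show ?thesis .
  qed
  ultimately show ?thesis
    by (simp cong: measurable_cong)
qed

section \<open>Contractions for weighted uniform distances\<close>

text \<open>Banach's fixed point theorem, where the distance of \<open>g\<close> and
  \<open>h\<close> is the least \<open>B\<close> with |g - h| \<le> B w on \<open>A\<close>.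
  Functions are compared on \<open>A\<close> only, so fixed points are unique there only. The bound
  by \<open>C * w\<close> keeps all distances finite, and \<open>closed\<close> takes the place of
  completeness.\<close>

lemma weighted_contraction_fixpoint:
  fixes T :: "('p \<Rightarrow> real) \<Rightarrow> 'p \<Rightarrow> real"
  assumes maps: "\<And>g. g \<in> S \<Longrightarrow> T g \<in> S"
    and ne: "start \<in> S"
    and bdd: "\<And>g p. g \<in> S \<Longrightarrow> p \<in> A \<Longrightarrow> \<bar>g p\<bar> \<le> C * w p"
    and w: "\<And>p. p \<in> A \<Longrightarrow> 0 \<le> w p"
    and closed: "\<And>h g B. (\<And>k. h k \<in> S) \<Longrightarrow>
      (\<And>k p. p \<in> A \<Longrightarrow> \<bar>h k p - g p\<bar> \<le> B / 2 ^ k * w p) \<Longrightarrow> g \<in> S"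
    and contr: "\<And>g h B. g \<in> S \<Longrightarrow> h \<in> S \<Longrightarrow> 0 \<le> B \<Longrightarrow>
      (\<And>p. p \<in> A \<Longrightarrow> \<bar>g p - h p\<bar> \<le> B * w p) \<Longrightarrow>
      (\<And>p. p \<in> A \<Longrightarrow> \<bar>T g p - T h p\<bar> \<le> B / 2 * w p)"
  obtains g where "g \<in> S" "\<And>p. p \<in> A \<Longrightarrow> T g p = g p"
    "\<And>h p. h \<in> S \<Longrightarrow> (\<And>p. p \<in> A \<Longrightarrow> T h p = h p) \<Longrightarrow> p \<in> A \<Longrightarrow> h p = g p"
proof -
  define h where "h k = (T ^^ k) start" for k
  have h0: "h 0 = start" and hS: "h (Suc k) = T (h k)" for k
    by (simp_all add: h_def)
  have h_in: "h k \<in> S" for k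
    by (induction k) (simp_all add: h0 hS ne maps)
  \<comment> \<open>\<open>C\<close> may be negative, for instance if \<open>A\<close> is empty,
    whereas \<open>contr\<close> asks for a nonnegative distance.\<close>
  define C' where "C' = \<bar>C\<bar>"
  have bdd': "\<bar>g p\<bar> \<le> C' * w p" if "g \<in> S" "p \<in> A" for g p
    using bdd[OF that] w[OF that(2)] mult_right_mono[of C C' "w p"] unfolding C'_def by fastforce
  have C': "0 \<le> C'" by (simp add: C'_def)
  have step: "\<bar>h (Suc k) p - h k p\<bar> \<le> 2 * C' / 2 ^ k * w p" if "p \<in> A" for k p
    using that
  proof (induction k arbitrary: p)
    case 0
    then show ?case
      using bdd'[OF h_in, of p "Suc 0"] bdd'[OF h_in, of p 0] by simp
  next
    case (Suc k)
    have "\<bar>T (h (Suc k)) p - T (h k) p\<bar> \<le> 2 * C' / 2 ^ k / 2 * w p"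
      by (rule contr[OF h_in h_in _ Suc.IH Suc.prems]) (use C' in auto)
    then show ?case by (simp add: hS)
  qed
  \<comment> \<open>The factor 1 - 1 / 2^j is the partial sum of the geometric series; it is what
    makes the induction on \<open>j\<close> close.\<close>
  have far: "\<bar>h (k + j) p - h k p\<bar> \<le> 4 * C' / 2 ^ k * w p * (1 - 1 / 2 ^ j)" if p: "p \<in> A" for k j p
  proof (induction j)
    case (Suc j)
    have "\<bar>h (k + Suc j) p - h k p\<bar> \<le> \<bar>h (Suc (k + j)) p - h (k + j) p\<bar> + \<bar>h (k + j) p - h k p\<bar>"
      by simp
    also have "\<dots> \<le> 2 * C' / 2 ^ (k + j) * w p + 4 * C' / 2 ^ k * w p * (1 - 1 / 2 ^ j)"
      using step[OF p, of "k + j"] Suc by linarith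
    also have "\<dots> = 4 * C' / 2 ^ k * w p * (1 - 1 / 2 ^ Suc j)"
      by (simp add: power_add field_simps)
    finally show ?case .
  qed simp
  have far': "\<bar>h (k + j) p - h k p\<bar> \<le> 4 * C' / 2 ^ k * w p" if p: "p \<in> A" for k j p
  proof -
    have "4 * C' / 2 ^ k * w p * (1 - 1 / 2 ^ j) \<le> 4 * C' / 2 ^ k * w p * 1"
      by (rule mult_left_mono) (use C' w[OF p] in auto)
    with far[OF p, of k j] show ?thesis by simp
  qed
  have null: "(\<lambda>k. B / 2 ^ k * v) \<longlonglongrightarrow> 0" for B v :: real
  proof -
    have "(\<lambda>k. B * v * (1 / 2) ^ k) \<longlonglongrightarrow> B * v * 0"
      by (intro tendsto_mult tendsto_const LIMSEQ_realpow_zero) auto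
    then show ?thesis by (simp add: power_one_over field_simps)
  qed
  have "\<exists>l. (\<lambda>k. h k p) \<longlonglongrightarrow> l" if p: "p \<in> A" for p
  proof -
    have "Cauchy (\<lambda>k. h k p)"
      unfolding Cauchy_altdef2
    proof (intro allI impI)
      fix e :: real assume "0 < e"
      from order_tendstoD(2)[OF null this, of "4 * C'" "w p"]
      obtain N where "4 * C' / 2 ^ N * w p < e"
        by (auto simp: eventually_sequentially)
      then have "dist (h k p) (h N p) < e" if "k \<ge> N" for k
        using far'[OF p, of N "k - N"] that by (simp add: dist_real_def)
      then show "\<exists>N. \<forall>n\<ge>N. dist (h n p) (h N p) < e" by blast
    qed
    then show ?thesis by (simp add: Cauchy_convergent_iff convergent_def)
  qed
  then obtain g where g: "(\<lambda>k. h k p) \<longlonglongrightarrow> g p" if "p \<in> A" for p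
    by metis
  have hg: "\<bar>h k p - g p\<bar> \<le> 4 * C' / 2 ^ k * w p" if p: "p \<in> A" for k p
  proof -
    have "(\<lambda>j. \<bar>h (k + j) p - h k p\<bar>) \<longlonglongrightarrow> \<bar>g p - h k p\<bar>"
      using LIMSEQ_ignore_initial_segment[OF g[OF p], of k]
      by (intro tendsto_intros) (simp add: add.commute)
    then have "\<bar>g p - h k p\<bar> \<le> 4 * C' / 2 ^ k * w p"
      by (rule LIMSEQ_le_const2) (use far'[OF p] in auto)
    then show ?thesis by (simp add: abs_minus_commute)
  qed
  have gS: "g \<in> S"
    by (rule closed[OF h_in hg])
  \<comment> \<open>Applying \<open>T\<close> leaves both fixed points in place but halves their
    distance, so the distance is below every 2 C' / 2^k.\<close>
  have fix_eq: "f p = f' p"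
    if f: "f \<in> S" "\<And>p. p \<in> A \<Longrightarrow> T f p = f p" and f': "f' \<in> S" "\<And>p. p \<in> A \<Longrightarrow> T f' p = f' p"
      and p: "p \<in> A" for f f' p
  proof -
    have "\<bar>f p - f' p\<bar> \<le> 2 * C' / 2 ^ k * w p" if "p \<in> A" for k p
      using that
    proof (induction k arbitrary: p)
      case 0
      then show ?case using bdd'[OF f(1) 0] bdd'[OF f'(1) 0] by simp
    next
      case (Suc k)
      have "\<bar>T f p - T f' p\<bar> \<le> 2 * C' / 2 ^ k / 2 * w p"
        by (rule contr[OF f(1) f'(1) _ Suc.IH Suc.prems]) (use C' in auto)
      then show ?case using f(2) f'(2) Suc.prems by simp
    qed
    then have "\<bar>f p - f' p\<bar> \<le> 0"
      by (intro LIMSEQ_le_const[OF null[of "2 * C'" "w p"]]) (use p in auto)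
    then show ?thesis by simp
  qed
  have gfix: "T g p = g p" if p: "p \<in> A" for p
  proof -
    \<comment> \<open>Both \<open>T g\<close> and \<open>g\<close> are close to
      \<open>T (h k)\<close>, the latter because \<open>T (h k)\<close> is the next iterate.\<close>
    have "\<bar>T g p - g p\<bar> \<le> 4 * C' / 2 ^ k * w p" for k
    proof -
      have "\<bar>T (h k) p - T g p\<bar> \<le> 4 * C' / 2 ^ k / 2 * w p"
        by (rule contr[OF h_in gS _ hg p]) (use C' in auto)
      moreover have "\<bar>T (h k) p - g p\<bar> \<le> 4 * C' / 2 ^ Suc k * w p"
        using hg[OF p, of "Suc k"] by (simp only: hS)
      ultimately show ?thesis by simp
    qed
    then have "\<bar>T g p - g p\<bar> \<le> 0"
      by (intro LIMSEQ_le_const[OF null[of "4 * C'" "w p"]]) auto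
    then show ?thesis by simp
  qed
  show thesis
    by (rule that[OF gS gfix]) (use fix_eq gS gfix in blast)+
qed

section \<open>Exponential tilting by a time-dependent rate\<close>

text \<open>The gain of 1 / k over the integrand matters twice: k = c bounds the exponent of a tilt
  uniformly in time, and k = c + l yields the contraction.\<close>

lemma abs_integral_le_exp:
  fixes f :: "real \<Rightarrow> real"
  assumes cont: "continuous_on {0..t} f" and k: "0 < k" and B: "0 \<le> B" and t: "0 \<le> t"
    and bound: "\<And>s. 0 \<le> s \<Longrightarrow> s \<le> t \<Longrightarrow> \<bar>f s\<bar> \<le> B * exp (k * s)"
  shows "\<bar>integral {0..t} f\<bar> \<le> B / k * exp (k * t)"
proof -
  have ex: "((\<lambda>s. B * exp (k * s)) has_integral (B / k * exp (k * t) - B / k * exp (k * 0))) {0..t}"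
  proof (rule fundamental_theorem_of_calculus[OF t])
    fix s assume "s \<in> {0..t}"
    show "((\<lambda>s. B / k * exp (k * s)) has_vector_derivative B * exp (k * s)) (at s within {0..t})"
      unfolding has_real_derivative_iff_has_vector_derivative[symmetric]
      by (rule derivative_eq_intros refl)+ (use k in auto)
  qed
  have "norm (integral {0..t} f) \<le> integral {0..t} (\<lambda>s. B * exp (k * s))"
    by (rule integral_norm_bound_integral)
      (use cont ex bound in \<open>auto intro: integrable_continuous_interval has_integral_integrable\<close>)
  also have "\<dots> = B / k * exp (k * t) - B / k"
    using integral_unique[OF ex] by simp
  also have "\<dots> \<le> B / k * exp (k * t)"
    using B k by simp
  finally show ?thesis by simp
qed

lemma integral_has_real_derivative_at_within_Ici:
  fixes f :: "real \<Rightarrow> real"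
  assumes "continuous_on {a..} f" and "a \<le> t"
  shows "((\<lambda>s. integral {a..s} f) has_real_derivative f t) (at t within {a..})"
proof -
  have "((\<lambda>s. integral {a..s} f) has_real_derivative f t) (at t within {a..t + 1})"
    by (rule integral_has_real_derivative)
      (use assms in \<open>auto intro: continuous_on_subset\<close>)
  also have "at t within {a..t + 1} = at t within {a..}"
    by (rule at_within_nhd[of _ "{..<t + 1}"]) auto
  finally show ?thesis .
qed

text \<open>Both sides come from ln z \<le> z - 1, taken at \<open>y\<close> and at
  \<open>1 / y\<close>. At y = 0 the product is 0. The crude constant suffices for domination and
  integrability.\<close>

lemma abs_mult_ln_le:
  fixes y :: real
  assumes "0 \<le> y" "y \<le> B"
  shows "\<bar>ln y * y\<bar> \<le> 1 + B\<^sup>2"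
proof (cases "y = 0")
  case False
  with assms have y: "0 < y" by simp
  have "ln y * y \<le> (y - 1) * y"
    using ln_le_minus_one[OF y] y by (intro mult_right_mono) auto
  also have "\<dots> \<le> B * B"
    using assms y by (intro mult_mono) auto
  finally have 1: "ln y * y \<le> B\<^sup>2"
    by (simp add: power2_eq_square)
  have "- ln y = ln (1 / y)"
    using y by (simp add: ln_div)
  then have "- ln y * y \<le> (1 / y - 1) * y"
    using ln_le_minus_one[of "1 / y"] y by (intro mult_right_mono) auto
  also have "\<dots> = 1 - y"
    using y by (simp add: field_simps)
  finally show ?thesis
    using 1 y zero_le_power2[of B] unfolding abs_le_iff mult_minus_left by linarith
qed simp

text \<open>Since \<open>0 powr a = 0\<close>, the tilt vanishes exactly where \<open>u0\<close>
  does. The factor exp (-ct) is pulled out of the integral so that the integrand does not depend on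
  the upper limit.\<close>

definition tilt :: "real \<Rightarrow> ('a \<Rightarrow> real) \<Rightarrow> (real \<Rightarrow> 'a \<Rightarrow> real) \<Rightarrow> real \<Rightarrow> 'a \<Rightarrow> real" where
  "tilt c u0 g t x = u0 x powr exp (- c * t) *
     exp (- (exp (- c * t) * integral {0..t} (\<lambda>s. exp (c * s) * g s x)))"

definition tilted ::
  "'a measure \<Rightarrow> real \<Rightarrow> ('a \<Rightarrow> real) \<Rightarrow> (real \<Rightarrow> 'a \<Rightarrow> real) \<Rightarrow> real \<Rightarrow> 'a \<Rightarrow> real" where
  "tilted M c u0 g t x = tilt c u0 g t x / (LINT y|M. tilt c u0 g t y)"

text \<open>Continuity in time serves to differentiate the inner integral of a tilt, measurability
  to normalise it, and the bound to control it for all times. All three survive the limits of the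
  fixed point iteration.\<close>

definition admissible_rate :: "'a measure \<Rightarrow> real \<Rightarrow> (real \<Rightarrow> 'a \<Rightarrow> real) \<Rightarrow> bool" where
  "admissible_rate M C g \<longleftrightarrow>
     (\<forall>x\<in>space M. continuous_on {0..} (\<lambda>s. g s x)) \<and>
     (\<forall>s\<ge>0. g s \<in> borel_measurable M) \<and>
     (\<forall>s\<ge>0. \<forall>x\<in>space M. \<bar>g s x\<bar> \<le> C)"

locale tilting = prob_space M for M :: "'a measure" +
  fixes c C R :: real and u0 :: "'a \<Rightarrow> real"
  assumes c: "0 < c" and C: "0 < C" and R: "1 \<le> R"
    and u0_measurable [measurable]: "u0 \<in> borel_measurable M"
    and u0_nonneg: "\<And>x. x \<in> space M \<Longrightarrow> 0 \<le> u0 x"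
    and u0_le: "\<And>x. x \<in> space M \<Longrightarrow> u0 x \<le> R"
    and u0_integral: "(LINT x|M. u0 x) = 1"
begin

text \<open>\<open>R\<close> bounds the power of \<open>u0\<close> in a tilt, and C / c bounds the
  modulus of its exponent.\<close>

definition K :: real where "K = R * exp (C / c)"

lemma K_ge_1: "1 \<le> K"
proof -
  have "1 * 1 \<le> R * exp (C / c)"
    using R C c by (intro mult_mono) auto
  then show ?thesis by (simp add: K_def)
qed

lemma u0_integrable: "integrable M u0"
  by (rule integrable_const_bound[where B = R]) (use u0_nonneg u0_le in auto)

lemma exists_u0_pos: "\<exists>x\<in>space M. 0 < u0 x"
proof (rule ccontr)
  assume "\<not> ?thesis"
  then have "(LINT x|M. u0 x) = (LINT x|M. 0)"
    using u0_nonneg by (intro Bochner_Integration.integral_cong) force+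
  with u0_integral show False by simp
qed

section \<open>Two-sided bounds for tilts and their normalisation\<close>

context
  fixes g assumes g: "admissible_rate M C g"
begin

abbreviation "I x t \<equiv> integral {0..t} (\<lambda>s. exp (c * s) * g s x)"

lemma
  shows g_cont: "x \<in> space M \<Longrightarrow> continuous_on {0..} (\<lambda>s. g s x)"
    and g_measurable: "0 \<le> s \<Longrightarrow> g s \<in> borel_measurable M"
    and g_bound: "0 \<le> s \<Longrightarrow> x \<in> space M \<Longrightarrow> \<bar>g s x\<bar> \<le> C"
  using g by (auto simp: admissible_rate_def)

lemma rate_cont: "x \<in> space M \<Longrightarrow> continuous_on {0..} (\<lambda>s. exp (c * s) * g s x)"
  by (intro continuous_intros g_cont)

lemma I_deriv:
  assumes "x \<in> space M" "0 \<le> t"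
  shows "(I x has_real_derivative exp (c * t) * g t x) (at t within {0..})"
  by (rule integral_has_real_derivative_at_within_Ici[OF rate_cont assms(2)]) fact

lemma I_cont: "x \<in> space M \<Longrightarrow> continuous_on {0..} (I x)"
  unfolding continuous_on_eq_continuous_within
  using I_deriv by (auto intro: DERIV_continuous)

lemma I_bound:
  assumes x: "x \<in> space M" and t: "0 \<le> t"
  shows "\<bar>exp (- c * t) * I x t\<bar> \<le> C / c"
proof -
  have "\<bar>I x t\<bar> \<le> C / c * exp (c * t)"
  proof (rule abs_integral_le_exp)
    show "continuous_on {0..t} (\<lambda>s. exp (c * s) * g s x)"
      by (rule continuous_on_subset[OF rate_cont[OF x]]) auto
    show "\<bar>exp (c * s) * g s x\<bar> \<le> C * exp (c * s)" if "0 \<le> s" "s \<le> t" for s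
      using g_bound[OF that(1) x] by (simp add: abs_mult)
  qed (use c C t in auto)
  then have "exp (- c * t) * \<bar>I x t\<bar> \<le> exp (- c * t) * (C / c * exp (c * t))"
    by (rule mult_left_mono) simp
  also have "\<dots> = C / c"
    by (simp add: exp_minus field_simps)
  finally show ?thesis by (simp add: abs_mult)
qed

lemma tilt_nonneg: "0 \<le> tilt c u0 g t x"
  by (simp add: tilt_def)

lemma tilt_eq_0_iff: "tilt c u0 g t x = 0 \<longleftrightarrow> u0 x = 0"
  by (simp add: tilt_def)

lemma tilt_eq_exp:
  "0 < u0 x \<Longrightarrow> tilt c u0 g t x = exp (exp (- c * t) * (ln (u0 x) - I x t))"
  by (simp add: tilt_def powr_def exp_add[symmetric] algebra_simps)

lemma tilt_le:
  assumes x: "x \<in> space M" and t: "0 \<le> t"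
  shows "tilt c u0 g t x \<le> K"
proof -
  have "u0 x powr exp (- c * t) \<le> R powr exp (- c * t)"
    by (rule powr_mono2) (use u0_nonneg u0_le x in auto)
  also have "\<dots> \<le> R powr 1"
    by (rule powr_mono) (use c t R in auto)
  finally have "u0 x powr exp (- c * t) \<le> R"
    using R by simp
  moreover have "exp (- (exp (- c * t) * I x t)) \<le> exp (C / c)"
    using I_bound[OF assms] by simp
  ultimately show ?thesis
    unfolding tilt_def K_def using R by (intro mult_mono) auto
qed

text \<open>Dividing by \<open>R\<close> brings the base into [0, 1], where lowering the exponent
  from 1 to exp (-ct) can only increase the power. The bound is proportional to \<open>u0\<close>,
  so it covers zeros of \<open>u0\<close> and integrates to a bound on the mass.\<close>

lemma tilt_ge:
  assumes x: "x \<in> space M" and t: "0 \<le> t"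
  shows "u0 x / K \<le> tilt c u0 g t x"
proof -
  have ux: "0 \<le> u0 x" "u0 x \<le> R"
    using u0_nonneg u0_le x by auto
  have "u0 x / R \<le> (u0 x / R) powr 1"
    using ux R by simp
  also have "\<dots> \<le> (u0 x / R) powr exp (- c * t)"
    by (rule powr_mono') (use ux R c t in auto)
  also have "\<dots> \<le> u0 x powr exp (- c * t)"
  proof (rule powr_mono2)
    have "u0 x * 1 \<le> u0 x * R"
      using ux R by (intro mult_left_mono) auto
    then show "u0 x / R \<le> u0 x"
      using R by (simp add: divide_le_eq)
  qed (use ux R in auto)
  finally have 1: "u0 x / R \<le> u0 x powr exp (- c * t)" .
  have 2: "exp (- (C / c)) \<le> exp (- (exp (- c * t) * I x t))"
    using I_bound[OF assms] by simp
  have "u0 x / R * exp (- (C / c)) \<le> tilt c u0 g t x"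
    unfolding tilt_def by (rule mult_mono[OF 1 2]) auto
  then show ?thesis
    by (simp add: K_def exp_minus field_simps)
qed

lemma tilt_measurable: "0 \<le> t \<Longrightarrow> tilt c u0 g t \<in> borel_measurable M"
proof -
  assume "0 \<le> t"
  have [measurable]: "(\<lambda>x. I x t) \<in> borel_measurable M"
    by (rule measurable_integral_of_continuous_parameter[OF rate_cont])
      (auto intro!: borel_measurable_times g_measurable)
  show ?thesis
    unfolding tilt_def by measurable
qed

lemma tilt_integrable: "0 \<le> t \<Longrightarrow> integrable M (tilt c u0 g t)"
  by (rule integrable_const_bound[where B = K])
    (use tilt_le tilt_nonneg tilt_measurable in auto)

text \<open>The pointwise bound \<open>u0 / K\<close> integrates to 1 / K because \<open>u0\<close>
  has mass one; this keeps the denominator of \<open>tilted\<close> away from 0.\<close>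

lemma Z_ge:
  assumes t: "0 \<le> t"
  shows "1 / K \<le> (LINT x|M. tilt c u0 g t x)"
proof -
  have "1 / K = (LINT x|M. u0 x / K)"
    using u0_integral by simp
  also have "\<dots> \<le> (LINT x|M. tilt c u0 g t x)"
    by (rule integral_mono) (use u0_integrable tilt_integrable tilt_ge t in auto)
  finally show ?thesis .
qed

lemma Z_le:
  assumes t: "0 \<le> t"
  shows "(LINT x|M. tilt c u0 g t x) \<le> K"
proof -
  have "(LINT x|M. tilt c u0 g t x) \<le> (LINT x|M. K)"
    by (rule integral_mono) (use tilt_integrable tilt_le t in auto)
  then show ?thesis by (simp add: prob_space)
qed

lemma Z_pos: "0 \<le> t \<Longrightarrow> 0 < (LINT x|M. tilt c u0 g t x)"
  using Z_ge[of t] K_ge_1 by (smt (verit) divide_pos_pos)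

lemma tilted_nonneg: "0 \<le> t \<Longrightarrow> 0 \<le> tilted M c u0 g t x"
  unfolding tilted_def using Z_pos[of t] tilt_nonneg[of t x] by simp

lemma tilted_le:
  assumes "x \<in> space M" "0 \<le> t"
  shows "tilted M c u0 g t x \<le> K\<^sup>2"
proof -
  have "tilted M c u0 g t x \<le> K / (1 / K)"
    unfolding tilted_def using tilt_le[OF assms] Z_ge[of t] K_ge_1 assms
    by (intro frac_le) auto
  then show ?thesis by (simp add: power2_eq_square)
qed

lemma tilted_ge:
  assumes "x \<in> space M" "0 \<le> t"
  shows "u0 x / K\<^sup>2 \<le> tilted M c u0 g t x"
proof -
  have "(u0 x / K) / K \<le> tilted M c u0 g t x"
    unfolding tilted_def using tilt_ge[OF assms] Z_le[of t] Z_pos[of t] K_ge_1 assms u0_nonneg tilt_nonneg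
    by (intro frac_le) auto
  then show ?thesis by (simp add: power2_eq_square)
qed

lemma tilted_integrable: "0 \<le> t \<Longrightarrow> integrable M (tilted M c u0 g t)"
  using tilt_integrable[of t] unfolding tilted_def by auto

lemma tilted_integral: "0 \<le> t \<Longrightarrow> (LINT x|M. tilted M c u0 g t x) = 1"
  using Z_pos[of t] unfolding tilted_def by simp

lemma tilted_0: "x \<in> space M \<Longrightarrow> tilted M c u0 g 0 x = u0 x"
proof -
  have eq: "tilt c u0 g 0 y = u0 y" if "y \<in> space M" for y
    using u0_nonneg[OF that] by (simp add: tilt_def)
  have "(LINT y|M. tilt c u0 g 0 y) = (LINT y|M. u0 y)"
    by (rule Bochner_Integration.integral_cong) (simp_all add: eq)
  then show "x \<in> space M \<Longrightarrow> ?thesis"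
    by (simp add: tilted_def eq u0_integral)
qed

section \<open>The differential equation of a normalised tilt\<close>

lemma tilt_deriv:
  assumes x: "x \<in> space M" and t: "0 \<le> t"
  shows "((\<lambda>s. tilt c u0 g s x) has_real_derivative
    - (g t x + c * ln (tilt c u0 g t x)) * tilt c u0 g t x) (at t within {0..})"
proof (cases "u0 x = 0")
  case True
  then show ?thesis by (simp add: tilt_def)
next
  case False
  with u0_nonneg[OF x] have pos: "0 < u0 x" by simp
  have *: "exp (- c * t) * exp (c * t) = 1"
    by (simp add: exp_minus)
  \<comment> \<open>The derivative of the outer factor exp (-ct) reproduces -c times the logarithm
    of the tilt; in the derivative of \<open>I\<close> the two exponentials cancel and leave
    -g.\<close>
  have "((\<lambda>s. exp (exp (- c * s) * (ln (u0 x) - I x s))) has_real_derivative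
    exp (exp (- c * t) * (ln (u0 x) - I x t)) *
      (- c * exp (- c * t) * (ln (u0 x) - I x t) - exp (- c * t) * exp (c * t) * g t x)) (at t within {0..})"
    by (rule derivative_eq_intros I_deriv[OF assms] refl)+ (simp add: algebra_simps)
  then show ?thesis
    by (simp only: tilt_eq_exp[OF pos] ln_exp *) (simp add: algebra_simps)
qed

lemma rate_tilt_bound:
  assumes x: "x \<in> space M" and t: "0 \<le> t"
  shows "\<bar>(g t x + c * ln (tilt c u0 g t x)) * tilt c u0 g t x\<bar> \<le> C * K + c * (1 + K\<^sup>2)"
proof -
  let ?y = "tilt c u0 g t x"
  have y: "0 \<le> ?y" "?y \<le> K"
    using tilt_nonneg tilt_le assms by auto
  have "\<bar>(g t x + c * ln ?y) * ?y\<bar> = \<bar>g t x * ?y + c * (ln ?y * ?y)\<bar>"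
    by (simp add: algebra_simps)
  also have "\<dots> \<le> \<bar>g t x\<bar> * ?y + c * \<bar>ln ?y * ?y\<bar>"
    using c y by (auto simp: abs_mult intro!: order_trans[OF abs_triangle_ineq])
  also have "\<dots> \<le> C * K + c * (1 + K\<^sup>2)"
    using g_bound[OF t x] y C c abs_mult_ln_le[OF y] by (intro add_mono mult_mono) auto
  finally show ?thesis .
qed

lemma Z_deriv:
  assumes t: "0 \<le> t"
  shows "((\<lambda>s. LINT x|M. tilt c u0 g s x) has_real_derivative
    (LINT x|M. - (g t x + c * ln (tilt c u0 g t x)) * tilt c u0 g t x)) (at t within {0..})"
  by (rule has_real_derivative_integral_of_bounded_derivative[where B = "C * K + c * (1 + K\<^sup>2)"
      and f' = "\<lambda>t x. - (g t x + c * ln (tilt c u0 g t x)) * tilt c u0 g t x"])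
    (use t tilt_integrable tilt_measurable g_measurable tilt_deriv rate_tilt_bound in
      \<open>auto simp del: minus_add_distrib mult_minus_left simp: abs_minus_cancel minus_mult_left[symmetric]
         intro!: borel_measurable_times borel_measurable_add borel_measurable_uminus borel_measurable_ln\<close>)

lemma tilted_deriv:
  assumes x: "x \<in> space M" and t: "0 \<le> t"
    and centred: "(LINT y|M. g t y * tilted M c u0 g t y) = 0"
  shows "((\<lambda>s. tilted M c u0 g s x) has_real_derivative
    - (g t x + c * ln (tilted M c u0 g t x)
        - c * (LINT y|M. tilted M c u0 g t y * ln (tilted M c u0 g t y))) * tilted M c u0 g t x)
    (at t within {0..})"
proof -
  define E where "E = tilt c u0 g t"
  define Z where "Z = (LINT y|M. E y)"
  \<comment> \<open>Minus the derivative of the normalisation \<open>Z\<close>. Centring removes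
    \<open>g\<close> from it, so that \<kappa> / Z - c ln Z is c times the entropy of E / Z.\<close>
  define \<kappa> where "\<kappa> = (LINT y|M. (g t y + c * ln (E y)) * E y)"
  have Z: "0 < Z"
    using Z_pos[OF t] by (simp add: Z_def E_def)
  have u: "tilted M c u0 g t y = E y / Z" for y
    by (simp add: tilted_def E_def Z_def)
  have E0: "0 \<le> E y" for y
    by (simp add: E_def tilt_nonneg)
  have E_le: "E y \<le> K" if "y \<in> space M" for y
    using tilt_le[OF that t] by (simp add: E_def)
  have [measurable]: "E \<in> borel_measurable M" "g t \<in> borel_measurable M"
    using tilt_measurable[OF t] g_measurable[OF t] by (simp_all add: E_def)
  \<comment> \<open>The factor \<open>E y\<close> is kept so that the identity also holds where
    \<open>E y = 0\<close>.\<close>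
  have ln_u: "ln (E y / Z) * E y = ln (E y) * E y - ln Z * E y" for y
    using E0[of y] Z by (cases "E y = 0") (auto simp: ln_div algebra_simps)
  have int_E: "integrable M E"
    using tilt_integrable[OF t] by (simp add: E_def)
  have int_gE: "integrable M (\<lambda>y. g t y * E y)"
    by (rule integrable_const_bound[where B = "C * K"])
      (use g_bound[OF t] E_le E0 C in \<open>auto simp: abs_mult intro!: mult_mono\<close>)
  have int_lE: "integrable M (\<lambda>y. ln (E y) * E y)"
    by (rule integrable_const_bound[where B = "1 + K\<^sup>2"])
      (use abs_mult_ln_le[OF E0 E_le] in auto)
  have gE0: "(LINT y|M. g t y * E y) = 0"
    using centred Z by (simp add: u)
  have "\<kappa> = (LINT y|M. g t y * E y + c * (ln (E y) * E y))"
    unfolding \<kappa>_def by (rule Bochner_Integration.integral_cong) (auto simp: algebra_simps)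
  also have "\<dots> = c * (LINT y|M. ln (E y) * E y)"
    using int_gE int_lE gE0 by simp
  finally have \<kappa>: "\<kappa> = c * (LINT y|M. ln (E y) * E y)" .
  have "(LINT y|M. E y / Z * ln (E y / Z)) = (LINT y|M. (ln (E y) * E y - ln Z * E y) / Z)"
    by (rule Bochner_Integration.integral_cong) (auto simp: ln_u[symmetric])
  also have "\<dots> = ((LINT y|M. ln (E y) * E y) - ln Z * Z) / Z"
    using int_lE int_E by (simp add: Z_def)
  finally have ent: "c * (LINT y|M. E y / Z * ln (E y / Z)) = \<kappa> / Z - c * ln Z"
    using Z by (simp add: \<kappa> diff_divide_distrib right_diff_distrib)
  have "(LINT y|M. - (g t y + c * ln (E y)) * E y) = - \<kappa>"
    by (simp add: \<kappa>_def minus_mult_left[symmetric] del: minus_add_distrib mult_minus_left)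
  then have dZ: "((\<lambda>s. LINT x|M. tilt c u0 g s x) has_real_derivative - \<kappa>) (at t within {0..})"
    using Z_deriv[OF t] by (simp only: E_def)
  have dE: "((\<lambda>s. tilt c u0 g s x) has_real_derivative - (g t x + c * ln (E x)) * E x) (at t within {0..})"
    using tilt_deriv[OF x t] by (simp only: E_def)
  have "((\<lambda>s. tilted M c u0 g s x) has_real_derivative
    (- (g t x + c * ln (E x)) * E x * Z - E x * - \<kappa>) / (Z * Z)) (at t within {0..})"
    unfolding tilted_def using DERIV_divide[OF dE dZ] Z by (simp add: E_def Z_def)
  moreover have "(- (g t x + c * ln (E x)) * E x * Z - E x * - \<kappa>) / (Z * Z) =
      - (g t x + c * ln (E x / Z) - (\<kappa> / Z - c * ln Z)) * (E x / Z)"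
  proof (cases "E x = 0")
    case False
    with E0[of x] have "0 < E x" by simp
    then show ?thesis
      using Z by (simp add: ln_div field_simps)
  qed simp
  ultimately show ?thesis
    by (simp only: u ent)
qed

lemma tilted_cont:
  assumes x: "x \<in> space M"
  shows "continuous_on {0..} (\<lambda>t. tilted M c u0 g t x)"
  unfolding tilted_def
proof (rule continuous_on_divide)
  show "continuous_on {0..} (\<lambda>t. tilt c u0 g t x)"
    unfolding continuous_on_eq_continuous_within
    using tilt_deriv[OF x] by (auto intro: DERIV_continuous)
  show "continuous_on {0..} (\<lambda>t. LINT y|M. tilt c u0 g t y)"
    unfolding continuous_on_eq_continuous_within
    using Z_deriv by (auto intro: DERIV_continuous)
  show "\<forall>t\<in>{0..}. (LINT y|M. tilt c u0 g t y) \<noteq> 0"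
    using Z_pos by force
qed

section \<open>Uniqueness of the density for a prescribed rate\<close>

text \<open>
  Along a solution, \<open>exp (c t) ln u + I\<close> has derivative \<open>exp (c t) k t\<close>, which does not depend on
  the point. So differences between two points are conserved, whatever the regularity of \<open>k\<close>,
  and the sign of \<open>k\<close> keeps a solution that starts positive away from zero.
\<close>

context
  fixes u :: "real \<Rightarrow> 'a \<Rightarrow> real" and k :: "real \<Rightarrow> real"
  assumes u_nonneg: "\<And>t x. 0 \<le> t \<Longrightarrow> x \<in> space M \<Longrightarrow> 0 \<le> u t x"
    and u_init: "\<And>x. x \<in> space M \<Longrightarrow> u 0 x = u0 x"
    and u_deriv: "\<And>t x. 0 \<le> t \<Longrightarrow> x \<in> space M \<Longrightarrow> ((\<lambda>s. u s x) has_real_derivative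
      - (g t x + c * ln (u t x) - k t) * u t x) (at t within {0..})"
    and k_nonneg: "\<And>t. 0 \<le> t \<Longrightarrow> 0 \<le> k t"
begin

abbreviation "V x t \<equiv> exp (c * t) * ln (u t x) + I x t"

lemma u_cont: "x \<in> space M \<Longrightarrow> continuous_on {0..} (\<lambda>t. u t x)"
  unfolding continuous_on_eq_continuous_within
  using u_deriv by (auto intro: DERIV_continuous)

lemma V_deriv:
  assumes x: "x \<in> space M" and t: "0 \<le> t" and pos: "0 < u t x"
  shows "(V x has_real_derivative exp (c * t) * k t) (at t within {0..})"
  by (rule derivative_eq_intros I_deriv[OF x t] u_deriv[OF t x] refl pos)+
    (use pos in \<open>simp add: field_simps\<close>)

lemma V_mono:
  assumes x: "x \<in> space M" and b: "0 \<le> b"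
    and pos: "\<And>t. 0 \<le> t \<Longrightarrow> t \<le> b \<Longrightarrow> 0 < u t x"
  shows "ln (u0 x) \<le> V x b"
proof -
  have "V x 0 \<le> V x b"
  proof (rule DERIV_nonneg_imp_increasing_open[OF b])
    fix t assume t: "0 < t" "t < b"
    have "(V x has_real_derivative exp (c * t) * k t) (at t within {0..})"
      by (rule V_deriv) (use x t pos in auto)
    moreover have "at t within {0..} = at t"
      using t by (intro at_within_interior) auto
    ultimately show "\<exists>y. (V x has_real_derivative y) (at t) \<and> 0 \<le> y"
      using k_nonneg[of t] t by auto
  next
    show "continuous_on {0..b} (V x)"
      using pos by (intro continuous_intros continuous_on_subset[OF u_cont[OF x]]
          continuous_on_subset[OF I_cont[OF x]]) fastforce+
  qed
  then show ?thesis using u_init[OF x] by simp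
qed

text \<open>Up to a first zero \<open>T\<close>, monotonicity of \<open>V\<close> says that
  \<open>u\<close> stays above the unnormalised tilt, as k \<ge> 0 only pushes upwards. Continuity
  carries this to \<open>T\<close>, where the tilt is still positive.\<close>

lemma u_pos:
  assumes x: "x \<in> space M" and pos: "0 < u0 x" and t: "0 \<le> t"
  shows "0 < u t x"
proof (rule ccontr)
  assume "\<not> 0 < u t x"
  define S where "S = {s \<in> {0..}. u s x = 0}"
  define T where "T = Inf S"
  have "t \<in> S"
    using \<open>\<not> 0 < u t x\<close> u_nonneg[OF t x] t by (simp add: S_def)
  have "closed S"
    unfolding S_def
    by (rule continuous_closed_preimage_constant[OF u_cont[OF x]]) auto
  have bdd: "bdd_below S"
    by (rule bdd_belowI[of _ 0]) (auto simp: S_def)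
  have "T \<in> S"
    unfolding T_def using closed_contains_Inf[OF _ bdd \<open>closed S\<close>] \<open>t \<in> S\<close> by blast
  then have T: "0 \<le> T" "u T x = 0" by (auto simp: S_def)
  have "T \<noteq> 0"
    using T u_init[OF x] pos by force
  with T have "0 < T" by simp
  have before: "0 < u s x" if "0 \<le> s" "s < T" for s
  proof (rule ccontr)
    assume "\<not> 0 < u s x"
    then have "s \<in> S"
      using u_nonneg[OF that(1) x] that by (simp add: S_def)
    then have "T \<le> s"
      unfolding T_def by (rule cInf_lower[OF _ bdd])
    with that show False by simp
  qed
  have "0 \<le> u s x - tilt c u0 g s x" if s: "s \<in> {0..<T}" for s
  proof -
    have "ln (u0 x) \<le> exp (c * s) * ln (u s x) + I x s"
      by (rule V_mono) (use x s before in auto)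
    then have "exp (- c * s) * (ln (u0 x) - I x s) \<le> exp (- c * s) * (exp (c * s) * ln (u s x))"
      by (intro mult_left_mono) auto
    also have "\<dots> = ln (u s x)"
      by (simp add: exp_minus)
    finally have le: "exp (- c * s) * (ln (u0 x) - I x s) \<le> ln (u s x)" .
    have us: "0 < u s x"
      using before s by auto
    have "tilt c u0 g s x \<le> u s x"
      using le unfolding tilt_eq_exp[OF pos] ln_ge_iff[OF us] .
    then show ?thesis by simp
  qed
  moreover have "continuous_on (closure {0..<T}) (\<lambda>s. u s x - tilt c u0 g s x)"
  proof -
    have "continuous_on {0..} (\<lambda>s. tilt c u0 g s x)"
      unfolding continuous_on_eq_continuous_within
      using tilt_deriv[OF x] by (auto intro: DERIV_continuous)
    then show ?thesis
      using \<open>0 < T\<close> by (intro continuous_on_subset[OF continuous_on_diff[OF u_cont[OF x]]]) auto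
  qed
  ultimately have "0 \<le> u T x - tilt c u0 g T x"
    using \<open>0 < T\<close> by (intro continuous_ge_on_closure[where S = "{0..<T}"
        and f = "\<lambda>s. u s x - tilt c u0 g s x" and x = T]) auto
  moreover have "0 < tilt c u0 g T x"
    using tilt_nonneg[of T x] tilt_eq_0_iff[of T x] pos by (simp add: less_le)
  ultimately show False using T by simp
qed

lemma V_diff_const:
  assumes x: "x \<in> space M" and y: "y \<in> space M" and a: "0 \<le> a" "a \<le> b"
    and pos: "\<And>t. a \<le> t \<Longrightarrow> t \<le> b \<Longrightarrow> 0 < u t x \<and> 0 < u t y"
  shows "V x a - V y a = V x b - V y b"
proof -
  have "\<exists>d. \<forall>t\<in>{a..b}. V x t - V y t = d"
  proof (rule has_field_derivative_zero_constant)
    show "((\<lambda>t. V x t - V y t) has_real_derivative 0) (at t within {a..b})" if "t \<in> {a..b}" for t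
    proof -
      have "((\<lambda>t. V x t - V y t) has_real_derivative exp (c * t) * k t - exp (c * t) * k t)
          (at t within {0..})"
        by (rule DERIV_diff[OF V_deriv[OF x] V_deriv[OF y]]) (use that a pos in auto)
      then show ?thesis
        using a by (auto elim!: DERIV_subset)
    qed
  qed auto
  then show ?thesis using a by auto
qed

text \<open>Since \<open>k\<close> may be unbounded, a solution could a priori leave 0. It is
  compared with a point \<open>y\<close> where \<open>u0\<close> is positive: after the last zero
  \<open>T\<close>, the difference of the \<open>V\<close> is constant, so \<open>u s x\<close>
  equals an expression \<open>r s\<close> that is continuous and positive down to \<open>T\<close>,
  contradicting \<open>u T x = 0\<close>.\<close>

lemma u_zero:
  assumes x: "x \<in> space M" and zero: "u0 x = 0" and t: "0 \<le> t"
  shows "u t x = 0"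
proof (rule ccontr)
  assume "u t x \<noteq> 0"
  then have ut: "0 < u t x"
    using u_nonneg[OF t x] by simp
  obtain y where y: "y \<in> space M" "0 < u0 y"
    using exists_u0_pos by blast
  define S where "S = {s \<in> {0..t}. u s x = 0}"
  define T where "T = Sup S"
  have "0 \<in> S"
    using u_init[OF x] zero t by (simp add: S_def)
  have "closed S"
    unfolding S_def
    by (rule continuous_closed_preimage_constant[OF continuous_on_subset[OF u_cont[OF x]]]) auto
  have bdd: "bdd_above S"
    by (rule bdd_aboveI[of _ t]) (auto simp: S_def)
  have "T \<in> S"
    unfolding T_def using closed_contains_Sup[OF _ bdd \<open>closed S\<close>] \<open>0 \<in> S\<close> by blast
  then have T: "0 \<le> T" "T \<le> t" "u T x = 0" by (auto simp: S_def)
  have "T \<noteq> t"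
    using ut T(3) by auto
  with T(2) have "T < t" by simp
  have after: "0 < u s x" if "T < s" "s \<le> t" for s
  proof (rule ccontr)
    assume "\<not> 0 < u s x"
    moreover have "0 \<le> s"
      using that T(1) by linarith
    ultimately have "s \<in> S"
      using u_nonneg[OF _ x, of s] that(2) by (simp add: S_def)
    then have "s \<le> T"
      unfolding T_def by (rule cSup_upper[OF _ bdd])
    with that show False by simp
  qed
  define d where "d = V x t - V y t"
  \<comment> \<open>Solves \<open>V x s - V y s = d\<close> for \<open>u s x\<close>; unlike
    \<open>V x\<close>, it makes sense at \<open>s = T\<close>.\<close>
  define r where "r s = u s y * exp (exp (- c * s) * (d - I x s + I y s))" for s
  have "u s x - r s = 0" if s: "s \<in> {T<..t}" for s
  proof -
    have uy: "0 < u s y" and ux: "0 < u s x"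
      using u_pos[OF y, of s] after s T by auto
    have "V x s - V y s = d"
      unfolding d_def by (rule V_diff_const) (use x y s T after u_pos in auto)
    then have "exp (c * s) * (ln (u s x) - ln (u s y)) = d - I x s + I y s"
      by (simp add: algebra_simps)
    then have "exp (- c * s) * (d - I x s + I y s) = exp (- c * s) * (exp (c * s) * (ln (u s x) - ln (u s y)))"
      by (simp only:)
    also have "\<dots> = ln (u s x) - ln (u s y)"
      by (simp add: exp_minus)
    finally show ?thesis
      using ux uy by (simp add: r_def exp_diff)
  qed
  moreover have "continuous_on (closure {T<..t}) (\<lambda>s. u s x - r s)"
    using \<open>T < t\<close> T(1) unfolding r_def
    by (intro continuous_on_subset[where s = "{0..}" and t = "closure {T<..t}"]
        continuous_intros u_cont x y I_cont) auto
  ultimately have "u T x - r T = 0"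
    using \<open>T < t\<close> by (intro continuous_constant_on_closure[where S = "{T<..t}"
        and f = "\<lambda>s. u s x - r s" and x = T]) auto
  moreover have "0 < r T"
    unfolding r_def using u_pos[OF y T(1)] by simp
  ultimately show False using T by simp
qed

text \<open>Comparison with a fixed point \<open>y\<close> gives
  \<open>u t x = q * tilt c u0 g t x\<close> with \<open>q\<close> independent of \<open>x\<close>.
  Unit mass forces \<open>q\<close> to be the inverse of the normalisation, without \<open>k\<close>
  ever being computed.\<close>

theorem eq_tilted:
  assumes int: "\<And>t. 0 \<le> t \<Longrightarrow> (LINT x|M. u t x) = 1"
    and x: "x \<in> space M" and t: "0 \<le> t"
  shows "u t x = tilted M c u0 g t x"
proof -
  obtain y where y: "y \<in> space M" "0 < u0 y"
    using exists_u0_pos by blast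
  have tilt_y: "0 < tilt c u0 g t y"
    using tilt_nonneg[of t y] tilt_eq_0_iff[of t y] y by (simp add: less_le)
  define q where "q = u t y / tilt c u0 g t y"
  have eq: "u t x = q * tilt c u0 g t x" if x: "x \<in> space M" for x
  proof (cases "u0 x = 0")
    case True
    then show ?thesis
      using u_zero[OF x True t] tilt_eq_0_iff[of t x] by simp
  next
    case False
    with u0_nonneg[OF x] have pos: "0 < u0 x" by simp
    have "V x 0 - V y 0 = V x t - V y t"
      by (rule V_diff_const) (use x y t pos u_pos in auto)
    then have "exp (c * t) * (ln (u t x) - ln (u t y)) = (ln (u0 x) - I x t) - (ln (u0 y) - I y t)"
      using u_init x y by (simp add: right_diff_distrib)
    then have "exp (- c * t) * (exp (c * t) * (ln (u t x) - ln (u t y))) =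
        exp (- c * t) * ((ln (u0 x) - I x t) - (ln (u0 y) - I y t))"
      by (simp only:)
    also have "exp (- c * t) * (exp (c * t) * (ln (u t x) - ln (u t y))) = ln (u t x) - ln (u t y)"
      by (simp add: exp_minus)
    finally have "exp (ln (u t x) - ln (u t y)) = tilt c u0 g t x / tilt c u0 g t y"
      by (simp only: tilt_eq_exp[OF pos] tilt_eq_exp[OF y(2)] exp_diff[symmetric] right_diff_distrib[symmetric])
    then show ?thesis
      using u_pos[OF x pos t] u_pos[OF y t] tilt_y by (simp add: exp_diff q_def field_simps)
  qed
  have "1 = (LINT x|M. q * tilt c u0 g t x)"
    using int[OF t] eq by (simp cong: Bochner_Integration.integral_cong)
  then have "1 = q * (LINT x|M. tilt c u0 g t x)"
    by simp
  then show ?thesis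
    using eq[OF x] Z_pos[OF t] by (simp add: tilted_def field_simps)
qed

end

end

text \<open>Unnormalised tilts are Lipschitz in their exponent, which is bounded; the normalisations
  inherit the estimate by integration, and both stay above 1 / K. What matters is the factor 1 / l,
  which can be made small.\<close>

lemma tilted_stable:
  assumes g: "admissible_rate M C g" and h: "admissible_rate M C h"
    and l: "0 < l" and B: "0 \<le> B"
    and gh: "\<And>s x. 0 \<le> s \<Longrightarrow> x \<in> space M \<Longrightarrow> \<bar>g s x - h s x\<bar> \<le> B * exp (l * s)"
    and x: "x \<in> space M" and t: "0 \<le> t"
  shows "\<bar>tilted M c u0 g t x - tilted M c u0 h t x\<bar> \<le> 2 * K ^ 4 / l * B * exp (l * t)"
proof -
  \<comment> \<open>Bound for the difference of the two exponents. The weighted integral contributes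
    exp ((c + l) t) / (c + l), and the prefactor of the tilt removes exp (ct).\<close>
  define \<delta> where "\<delta> = B / l * exp (l * t)"
  have \<delta>: "0 \<le> \<delta>"
    using B l by (simp add: \<delta>_def)
  have tilt: "\<bar>tilt c u0 g t y - tilt c u0 h t y\<bar> \<le> K * \<delta>" if y: "y \<in> space M" for y
  proof -
    define a b where "a = exp (- c * t) * integral {0..t} (\<lambda>s. exp (c * s) * g s y)"
      and "b = exp (- c * t) * integral {0..t} (\<lambda>s. exp (c * s) * h s y)"
    have ci: "continuous_on {0..t} (\<lambda>s. exp (c * s) * g s y)" "continuous_on {0..t} (\<lambda>s. exp (c * s) * h s y)"
      by (rule continuous_on_subset[OF rate_cont[OF g y]] continuous_on_subset[OF rate_cont[OF h y]]; auto)+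
    have "\<bar>integral {0..t} (\<lambda>s. exp (c * s) * g s y - exp (c * s) * h s y)\<bar>
        \<le> B / (c + l) * exp ((c + l) * t)"
    proof (rule abs_integral_le_exp)
      show "\<bar>exp (c * s) * g s y - exp (c * s) * h s y\<bar> \<le> B * exp ((c + l) * s)"
        if "0 \<le> s" "s \<le> t" for s
      proof -
        have "\<bar>exp (c * s) * g s y - exp (c * s) * h s y\<bar> = exp (c * s) * \<bar>g s y - h s y\<bar>"
          by (simp add: abs_mult flip: right_diff_distrib)
        also have "\<dots> \<le> exp (c * s) * (B * exp (l * s))"
          using gh[OF that(1) y] by simp
        finally show ?thesis
          by (simp add: distrib_right exp_add algebra_simps)
      qed
    qed (use ci c l B t in \<open>auto intro!: continuous_on_diff\<close>)
    then have "exp (- c * t) * \<bar>integral {0..t} (\<lambda>s. exp (c * s) * g s y - exp (c * s) * h s y)\<bar>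
        \<le> exp (- c * t) * (B / (c + l) * exp ((c + l) * t))"
      by (rule mult_left_mono) simp
    also have "\<dots> = B / (c + l) * exp (l * t)"
      by (simp add: distrib_right exp_add exp_minus field_simps)
    also have "\<dots> \<le> \<delta>"
      unfolding \<delta>_def using B l c by (intro mult_right_mono divide_left_mono) auto
    also have "integral {0..t} (\<lambda>s. exp (c * s) * g s y - exp (c * s) * h s y) =
        integral {0..t} (\<lambda>s. exp (c * s) * g s y) - integral {0..t} (\<lambda>s. exp (c * s) * h s y)"
      using ci by (intro Henstock_Kurzweil_Integration.integral_diff integrable_continuous_interval)
    finally have ab: "\<bar>a - b\<bar> \<le> \<delta>"
      by (simp add: a_def b_def abs_mult flip: right_diff_distrib)
    \<comment> \<open>Both exponents lie below C / c, where the exponential has Lipschitz constant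
      exp (C / c).\<close>
    have "\<bar>exp (- a) - exp (- b)\<bar> \<le> exp (C / c) * \<bar>(- a) - (- b)\<bar>"
    proof -
      have ab': "- a \<in> {..C / c}" "- b \<in> {..C / c}"
        using I_bound[OF g y t] I_bound[OF h y t] unfolding a_def b_def by auto
      have "norm (exp (- a) - exp (- b)) \<le> exp (C / c) * norm ((- a) - (- b))"
      proof (rule field_differentiable_bound[where S = "{..C / c}" and f' = exp])
        show "(exp has_real_derivative exp z) (at z within {..C / c})" for z :: real
          by (rule DERIV_subset[OF DERIV_exp]) auto
      qed (use ab' in auto)
      then show ?thesis by simp
    qed
    also have "\<dots> \<le> exp (C / c) * \<delta>"
      using ab by simp
    finally have e: "\<bar>exp (- a) - exp (- b)\<bar> \<le> exp (C / c) * \<delta>" .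
    have "u0 y powr exp (- c * t) \<le> R powr exp (- c * t)"
      by (rule powr_mono2) (use u0_nonneg u0_le y in auto)
    also have "\<dots> \<le> R powr 1"
      by (rule powr_mono) (use c t R in auto)
    finally have p: "u0 y powr exp (- c * t) \<le> R"
      using R by simp
    have "\<bar>tilt c u0 g t y - tilt c u0 h t y\<bar> = u0 y powr exp (- c * t) * \<bar>exp (- a) - exp (- b)\<bar>"
      by (simp add: tilt_def a_def b_def abs_mult flip: right_diff_distrib)
    also have "\<dots> \<le> R * (exp (C / c) * \<delta>)"
      using p e R by (intro mult_mono) auto
    finally show ?thesis by (simp add: K_def)
  qed
  define Zg Zh where "Zg = (LINT y|M. tilt c u0 g t y)" and "Zh = (LINT y|M. tilt c u0 h t y)"
  have Z: "1 / K \<le> Zg" "1 / K \<le> Zh" "0 < Zg" "0 < Zh"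
    using Z_ge[OF g t] Z_ge[OF h t] Z_pos[OF g t] Z_pos[OF h t] by (auto simp: Zg_def Zh_def)
  have invZ: "1 / Zg \<le> K" "1 / Zh \<le> K"
    using Z K_ge_1 by (auto simp: field_simps)
  have "\<bar>Zg - Zh\<bar> = \<bar>LINT y|M. tilt c u0 g t y - tilt c u0 h t y\<bar>"
    using tilt_integrable[OF g t] tilt_integrable[OF h t] by (simp add: Zg_def Zh_def)
  also have "\<dots> \<le> (LINT y|M. \<bar>tilt c u0 g t y - tilt c u0 h t y\<bar>)"
    by (rule integral_abs_bound)
  also have "\<dots> \<le> (LINT y|M. K * \<delta>)"
    by (rule integral_mono) (use tilt tilt_integrable[OF g t] tilt_integrable[OF h t] in auto)
  finally have dZ: "\<bar>Zg - Zh\<bar> \<le> K * \<delta>"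
    by (simp add: prob_space)
  \<comment> \<open>Separates the change of the numerator from that of the normalisation. Each
    inverse normalisation, and the tilt itself, costs a factor K.\<close>
  have "tilted M c u0 g t x - tilted M c u0 h t x =
      (tilt c u0 g t x - tilt c u0 h t x) * (1 / Zg) + tilt c u0 h t x * (Zh - Zg) * (1 / Zg) * (1 / Zh)"
    using Z by (simp add: tilted_def Zg_def[symmetric] Zh_def[symmetric] field_simps)
  also have "\<bar>\<dots>\<bar> \<le> \<bar>tilt c u0 g t x - tilt c u0 h t x\<bar> * (1 / Zg) +
      tilt c u0 h t x * \<bar>Zg - Zh\<bar> * (1 / Zg) * (1 / Zh)"
    using Z tilt_nonneg[OF h] by (auto simp: abs_mult abs_minus_commute intro!: order_trans[OF abs_triangle_ineq])
  also have "\<dots> \<le> (K * \<delta>) * K + K * (K * \<delta>) * K * K"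
    using invZ Z tilt[OF x] dZ tilt_le[OF h x t] tilt_nonneg[OF h] \<delta> K_ge_1
    by (intro add_mono mult_mono) auto
  also have "\<dots> = \<delta> * K\<^sup>2 + \<delta> * K ^ 4"
    by (simp add: power2_eq_square power4_eq_xxxx algebra_simps)
  also have "\<dots> \<le> \<delta> * K ^ 4 + \<delta> * K ^ 4"
    using \<delta> K_ge_1 by (intro add_mono mult_left_mono power_increasing) auto
  finally show ?thesis
    by (simp add: \<delta>_def field_simps)
qed

end

section \<open>Mean-field systems of tilted densities\<close>

definition probability_density :: "'a measure \<Rightarrow> ('a \<Rightarrow> real) \<Rightarrow> bool" where
  "probability_density M v \<longleftrightarrow>
     integrable M v \<and> (\<forall>x\<in>space M. 0 \<le> v x) \<and> (LINT x|M. v x) = 1"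

lemma (in tilting) probability_density_tilted:
  "admissible_rate M C g \<Longrightarrow> 0 \<le> t \<Longrightarrow> probability_density M (tilted M c u0 g t)"
  by (simp add: probability_density_def tilted_integrable tilted_nonneg tilted_integral)

text \<open>The weight is bounded on every {0..b}, so the convergence is uniform there and
  continuity in time passes to the limit; measurability and the bound need only pointwise
  convergence.\<close>

lemma admissible_rate_limit:
  fixes h :: "nat \<Rightarrow> real \<Rightarrow> 'a \<Rightarrow> real"
  assumes h: "\<And>k. admissible_rate M C (h k)"
    and hg: "\<And>k t x. 0 \<le> t \<Longrightarrow> x \<in> space M \<Longrightarrow> \<bar>h k t x - g t x\<bar> \<le> B / 2 ^ k * exp (l * t)"
    and l: "0 \<le> l"
  shows "admissible_rate M C g"
proof -
  have null: "(\<lambda>k. \<bar>B\<bar> / 2 ^ k * v) \<longlonglongrightarrow> 0" for v :: real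
  proof -
    have "(\<lambda>k. \<bar>B\<bar> * v * (1 / 2) ^ k) \<longlonglongrightarrow> \<bar>B\<bar> * v * 0"
      by (intro tendsto_mult tendsto_const LIMSEQ_realpow_zero) auto
    then show ?thesis by (simp add: power_one_over field_simps)
  qed
  have unif: "uniform_limit {0..b} (\<lambda>k t. h k t x) (\<lambda>t. g t x) sequentially"
    if x: "x \<in> space M" for x b
  proof (rule uniform_limitI)
    fix e :: real assume "0 < e"
    from order_tendstoD(2)[OF null[of "exp (l * b)"] this]
    show "\<forall>\<^sub>F k in sequentially. \<forall>t\<in>{0..b}. dist (h k t x) (g t x) < e"
    proof eventually_elim
      case (elim k)
      show ?case
      proof
        fix t assume t: "t \<in> {0..b}"
        have "\<bar>h k t x - g t x\<bar> \<le> B / 2 ^ k * exp (l * t)"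
          using hg x t by simp
        also have "\<dots> \<le> \<bar>B\<bar> / 2 ^ k * exp (l * b)"
          using t l by (intro mult_mono divide_right_mono) (auto intro: mult_left_mono)
        finally show "dist (h k t x) (g t x) < e"
          using elim by (simp add: dist_real_def)
      qed
    qed
  qed
  have lim: "(\<lambda>k. h k t x) \<longlonglongrightarrow> g t x" if "0 \<le> t" "x \<in> space M" for t x
    by (rule tendsto_uniform_limitI[OF unif[of x t]]) (use that in auto)
  show ?thesis
    unfolding admissible_rate_def
  proof (intro conjI ballI allI impI)
    fix x assume x: "x \<in> space M"
    have "continuous_on {0..b} (\<lambda>t. g t x)" for b
      by (rule uniform_limit_theorem[OF always_eventually unif[OF x]])
        (use h x in \<open>auto simp: admissible_rate_def intro: continuous_on_subset[of "{0..}"]\<close>)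
    note c = this
    show "continuous_on {0..} (\<lambda>t. g t x)"
      unfolding continuous_on_eq_continuous_within
    proof
      fix t :: real assume "t \<in> {0..}"
      then have "continuous (at t within {0..t + 1}) (\<lambda>t. g t x)"
        using c[of "t + 1"] by (auto simp: continuous_on_eq_continuous_within)
      also have "at t within {0..t + 1} = at t within {0..}"
        by (rule at_within_nhd[of _ "{..<t + 1}"]) auto
      finally show "continuous (at t within {0..}) (\<lambda>t. g t x)" .
    qed
  next
    fix t :: real assume t: "0 \<le> t"
    show "g t \<in> borel_measurable M"
      by (rule borel_measurable_LIMSEQ_real[OF lim[OF t]])
        (use h t in \<open>auto simp: admissible_rate_def\<close>)
  next
    fix t :: real and x assume "0 \<le> t" "x \<in> space M"
    then show "\<bar>g t x\<bar> \<le> C"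
      by (intro LIMSEQ_le_const2[OF tendsto_rabs[OF lim]])
        (use h in \<open>auto simp: admissible_rate_def\<close>)
  qed
qed

text \<open>The components interact only through \<open>G\<close>, so any finite number of them can
  be treated at once. The application takes \<open>bool\<close> as index type, with
  \<open>True\<close> for the \<nu>-component.\<close>

locale tilting_system =
  fixes M :: "'i::finite \<Rightarrow> 'a measure" and c :: real and C R :: "'i \<Rightarrow> real"
    and u0 :: "'i \<Rightarrow> 'a \<Rightarrow> real"
    and G :: "('i \<Rightarrow> 'a \<Rightarrow> real) \<Rightarrow> 'i \<Rightarrow> 'a \<Rightarrow> real" and L :: real
  assumes tilting: "\<And>i. tilting (M i) c (C i) (R i) (u0 i)"
    and G_measurable: "\<And>v i. (\<And>j. probability_density (M j) (v j)) \<Longrightarrow>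
      G v i \<in> borel_measurable (M i)"
    and G_bound: "\<And>v i x. (\<And>j. probability_density (M j) (v j)) \<Longrightarrow> x \<in> space (M i) \<Longrightarrow>
      \<bar>G v i x\<bar> \<le> C i"
    and G_centred: "\<And>v i. (\<And>j. probability_density (M j) (v j)) \<Longrightarrow>
      (LINT x|M i. G v i x * v i x) = 0"
    and L: "0 \<le> L"
    and G_lipschitz: "\<And>v w i x. (\<And>j. probability_density (M j) (v j)) \<Longrightarrow>
      (\<And>j. probability_density (M j) (w j)) \<Longrightarrow> x \<in> space (M i) \<Longrightarrow>
      \<bar>G v i x - G w i x\<bar> \<le> L * (\<Sum>j\<in>UNIV. LINT y|M j. \<bar>v j y - w j y\<bar>)"
begin

sublocale tilting "M i" c "C i" "R i" "u0 i" for i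
  by (rule tilting)

text \<open>Pointwise continuity of probability densities is continuity in mean, which
  \<open>G_lipschitz\<close> turns into continuity of the rate. No bound on the densities enters, so
  the lemma serves the iterates and an arbitrary competing flow alike.\<close>

lemma admissible_rate_G:
  assumes dens: "\<And>t j. 0 \<le> t \<Longrightarrow> probability_density (M j) (v t j)"
    and cont: "\<And>j x. x \<in> space (M j) \<Longrightarrow> continuous_on {0..} (\<lambda>t. v t j x)"
  shows "admissible_rate (M i) (C i) (\<lambda>t. G (v t) i)"
  unfolding admissible_rate_def
proof (intro conjI ballI allI impI)
  fix x assume x: "x \<in> space (M i)"
  show "continuous_on {0..} (\<lambda>t. G (v t) i x)"
    unfolding continuous_on_def
  proof
    fix t :: real assume t: "t \<in> {0..}"
    have "((\<lambda>s. LINT y|M j. \<bar>v s j y - v t j y\<bar>) \<longlongrightarrow> 0) (at t within {0..})" for j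
      by (rule L1_continuous_of_probability_densities)
        (use dens cont t in \<open>auto simp: probability_density_def\<close>)
    then have "((\<lambda>s. L * (\<Sum>j\<in>UNIV. LINT y|M j. \<bar>v s j y - v t j y\<bar>)) \<longlongrightarrow> L * (\<Sum>j\<in>(UNIV::'i set). 0))
        (at t within {0..})"
      by (intro tendsto_mult tendsto_const tendsto_sum)
    then have lim: "((\<lambda>s. L * (\<Sum>j\<in>UNIV. LINT y|M j. \<bar>v s j y - v t j y\<bar>)) \<longlongrightarrow> 0) (at t within {0..})"
      by simp
    have "\<forall>\<^sub>F s in at t within {0..}.
        norm (G (v s) i x - G (v t) i x) \<le> L * (\<Sum>j\<in>UNIV. LINT y|M j. \<bar>v s j y - v t j y\<bar>)"
      unfolding eventually_at_filter
      by (rule always_eventually) (use G_lipschitz[OF dens dens x] t in auto)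
    from Lim_null_comparison[OF this lim]
    show "((\<lambda>t. G (v t) i x) \<longlongrightarrow> G (v t) i x) (at t within {0..})"
      by (simp add: Lim_null[symmetric])
  qed
qed (use dens G_measurable G_bound in auto)

text \<open>Existence comes with the entropy as the normalising term, while uniqueness holds against
  any nonnegative term \<open>k i t\<close> that is constant in space. A competitor's entropy thus
  needs nothing but its sign.\<close>

theorem exists_unique_flow:
  obtains u :: "real \<Rightarrow> 'i \<Rightarrow> 'a \<Rightarrow> real"
  where "\<And>t i. 0 \<le> t \<Longrightarrow> probability_density (M i) (u t i)"
    and "\<And>i x. x \<in> space (M i) \<Longrightarrow> u 0 i x = u0 i x"
    and "\<And>t i x. 0 \<le> t \<Longrightarrow> x \<in> space (M i) \<Longrightarrow> ((\<lambda>s. u s i x) has_real_derivative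
      - (G (u t) i x + c * ln (u t i x) - c * (LINT y|M i. u t i y * ln (u t i y))) * u t i x)
      (at t within {0..})"
    and "\<And>t i x. 0 \<le> t \<Longrightarrow> x \<in> space (M i) \<Longrightarrow>
      u0 i x / (R i * exp (C i / c))\<^sup>2 \<le> u t i x \<and> u t i x \<le> (R i * exp (C i / c))\<^sup>2"
    and "\<And>v k t i x. \<lbrakk>\<And>t i. 0 \<le> t \<Longrightarrow> probability_density (M i) (v t i);
      \<And>i x. x \<in> space (M i) \<Longrightarrow> v 0 i x = u0 i x;
      \<And>t i x. 0 \<le> t \<Longrightarrow> x \<in> space (M i) \<Longrightarrow> ((\<lambda>s. v s i x) has_real_derivative
        - (G (v t) i x + c * ln (v t i x) - k i t) * v t i x) (at t within {0..});
      \<And>t i. 0 \<le> t \<Longrightarrow> 0 \<le> k i t; 0 \<le> t; x \<in> space (M i)\<rbrakk> \<Longrightarrow> v t i x = u t i x"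
proof -
  \<comment> \<open>Index, time and point are packed into one argument, so that the rates of all
    components form a single function; only its values on \<open>A\<close> are meaningful.\<close>
  define A where "A = {(i, t, x). 0 \<le> (t::real) \<and> x \<in> space (M i)}"
  define S where "S = {g. \<forall>i. admissible_rate (M i) (C i) (\<lambda>t x. g (i, t, x))}"
  define sol where "sol g t i = tilted (M i) c (u0 i) (\<lambda>t x. g (i, t, x)) t" for g t i
  define T where "T g = (\<lambda>(i, t, x). G (sol g t) i x)" for g
  \<comment> \<open>Stability costs 2 \<open>K ^ 4\<close> / l for each component and
    \<open>G\<close> a factor L, so this choice contracts by 1 / 2. The summand 1 keeps
    \<open>l\<close> positive when L = 0.\<close>
  define l where "l = 4 * L * (\<Sum>j\<in>UNIV. (K j) ^ 4) + 1"
  have l: "0 < l"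
  proof -
    have "0 \<le> L * (\<Sum>j\<in>UNIV. (K j) ^ 4)"
      using L by (intro mult_nonneg_nonneg sum_nonneg) auto
    then show ?thesis by (simp add: l_def)
  qed
  have sol_dens: "probability_density (M i) (sol g t i)" if "g \<in> S" "0 \<le> t" for g t i
    using probability_density_tilted that unfolding sol_def S_def by auto
  have sol_cont: "continuous_on {0..} (\<lambda>t. sol g t i x)" if "g \<in> S" "x \<in> space (M i)" for g i x
    using tilted_cont that unfolding sol_def S_def by auto
  have TS: "T g \<in> S" if "g \<in> S" for g
    using admissible_rate_G[of "sol g", OF sol_dens[OF that] sol_cont[OF that]]
    by (simp add: S_def T_def)
  have "\<exists>g\<in>S. (\<forall>p\<in>A. T g p = g p) \<and>
      (\<forall>h\<in>S. (\<forall>p\<in>A. T h p = h p) \<longrightarrow> (\<forall>p\<in>A. h p = g p))"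
  proof (rule weighted_contraction_fixpoint[where S = S and T = T and A = A
        and w = "\<lambda>(i, t, x). exp (l * t)" and C = "\<Sum>i\<in>UNIV. C i" and start = "\<lambda>_. 0"])
    show "(\<lambda>_. 0) \<in> S"
      using C by (auto simp: S_def admissible_rate_def less_imp_le)
    show "\<bar>g p\<bar> \<le> (\<Sum>i\<in>UNIV. C i) * (case p of (i, t, x) \<Rightarrow> exp (l * t))"
      if g: "g \<in> S" and p: "p \<in> A" for g p
    proof -
      obtain i t x where p': "p = (i, t, x)" by (cases p)
      have "\<bar>g p\<bar> \<le> C i"
        using g p unfolding S_def A_def p' admissible_rate_def by auto
      also have "\<dots> \<le> (\<Sum>i\<in>UNIV. C i)"
        using C by (intro member_le_sum) (auto simp: less_imp_le)
      also have "\<dots> * 1 \<le> (\<Sum>i\<in>UNIV. C i) * exp (l * t)"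
        using C l p by (intro mult_left_mono sum_nonneg) (auto simp: A_def p' less_imp_le)
      finally show ?thesis by (simp add: p')
    qed
    show "g \<in> S" if h: "\<And>k. h k \<in> S"
      and hg: "\<And>k p. p \<in> A \<Longrightarrow> \<bar>h k p - g p\<bar> \<le> B / 2 ^ k * (case p of (i, t, x) \<Rightarrow> exp (l * t))"
      for h g B
    proof -
      have "admissible_rate (M i) (C i) (\<lambda>t x. g (i, t, x))" for i
      proof (rule admissible_rate_limit[where h = "\<lambda>k t x. h k (i, t, x)" and B = B and l = l])
        show "\<bar>h k (i, t, x) - g (i, t, x)\<bar> \<le> B / 2 ^ k * exp (l * t)"
          if "0 \<le> t" "x \<in> space (M i)" for k t x
          using hg[of "(i, t, x)" k] that by (simp add: A_def)
      qed (use h l in \<open>auto simp: S_def\<close>)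
      then show ?thesis by (simp add: S_def)
    qed
    show "\<bar>T g p - T h p\<bar> \<le> B / 2 * (case p of (i, t, x) \<Rightarrow> exp (l * t))"
      if g: "g \<in> S" and h: "h \<in> S" and B: "0 \<le> B"
      and gh: "\<And>p. p \<in> A \<Longrightarrow> \<bar>g p - h p\<bar> \<le> B * (case p of (i, t, x) \<Rightarrow> exp (l * t))"
      and p: "p \<in> A" for g h B p
    proof -
      obtain i t x where p': "p = (i, t, x)" by (cases p)
      with p have t: "0 \<le> t" and x: "x \<in> space (M i)" by (auto simp: A_def)
      have dist: "(LINT y|M j. \<bar>sol g t j y - sol h t j y\<bar>) \<le> 2 * (K j) ^ 4 / l * B * exp (l * t)" for j
      proof -
        have "(LINT y|M j. \<bar>sol g t j y - sol h t j y\<bar>) \<le> (LINT y|M j. 2 * (K j) ^ 4 / l * B * exp (l * t))"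
        proof (rule integral_mono)
          show "\<bar>sol g t j y - sol h t j y\<bar> \<le> 2 * (K j) ^ 4 / l * B * exp (l * t)"
            if y: "y \<in> space (M j)" for y
            unfolding sol_def
          proof (rule tilted_stable[OF _ _ l B _ y t])
            show "\<bar>g (j, s, z) - h (j, s, z)\<bar> \<le> B * exp (l * s)"
              if "0 \<le> s" "z \<in> space (M j)" for s z
              using gh[of "(j, s, z)"] that by (simp add: A_def)
          qed (use g h in \<open>auto simp: S_def\<close>)
          show "integrable (M j) (\<lambda>y. \<bar>sol g t j y - sol h t j y\<bar>)"
            using sol_dens[OF g t, of j] sol_dens[OF h t, of j]
            by (auto simp: probability_density_def)
        qed auto
        then show ?thesis by (simp add: prob_space)
      qed
      have "\<bar>T g p - T h p\<bar> \<le> L * (\<Sum>j\<in>UNIV. LINT y|M j. \<bar>sol g t j y - sol h t j y\<bar>)"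
        using G_lipschitz[OF sol_dens[OF g t] sol_dens[OF h t] x] by (simp add: T_def p')
      also have "\<dots> \<le> L * (\<Sum>j\<in>UNIV. 2 * (K j) ^ 4 / l * B * exp (l * t))"
        using dist L by (intro mult_left_mono sum_mono) auto
      also have "\<dots> = (4 * L * (\<Sum>j\<in>UNIV. (K j) ^ 4)) / l * (B / 2 * exp (l * t))"
        by (simp add: sum_distrib_left sum_distrib_right sum_divide_distrib field_simps)
      also have "\<dots> \<le> 1 * (B / 2 * exp (l * t))"
        using l B by (intro mult_right_mono) (auto simp: l_def)
      finally show ?thesis by (simp add: p')
    qed
    show "0 \<le> (case p of (i, t, x) \<Rightarrow> exp (l * t))" for p :: "'i \<times> real \<times> 'a"
      by (cases p) simp
  qed (use TS in blast)+
  then obtain g where g: "g \<in> S" and fix_g: "\<And>p. p \<in> A \<Longrightarrow> T g p = g p"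
    and uniq: "\<And>h p. h \<in> S \<Longrightarrow> (\<And>p. p \<in> A \<Longrightarrow> T h p = h p) \<Longrightarrow> p \<in> A \<Longrightarrow> h p = g p"
    by blast
  have G_sol: "G (sol g t) i x = g (i, t, x)" if "0 \<le> t" "x \<in> space (M i)" for t i x
    using fix_g[of "(i, t, x)"] that by (simp add: T_def A_def)
  have gi: "admissible_rate (M i) (C i) (\<lambda>t x. g (i, t, x))" for i
    using g by (simp add: S_def)
  show thesis
  proof (rule that[of "sol g"])
    fix t :: real and i x assume t: "0 \<le> t" and x: "x \<in> space (M i)"
    \<comment> \<open>Centring is known for values of \<open>G\<close> only; it applies to
      \<open>g\<close> because \<open>g\<close> is a fixed point.\<close>
    have "(LINT y|M i. g (i, t, y) * sol g t i y) = (LINT y|M i. G (sol g t) i y * sol g t i y)"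
      using G_sol[OF t] by (intro Bochner_Integration.integral_cong) auto
    also have "\<dots> = 0"
      by (rule G_centred[OF sol_dens[OF g t]])
    finally show "((\<lambda>s. sol g s i x) has_real_derivative
      - (G (sol g t) i x + c * ln (sol g t i x) - c * (LINT y|M i. sol g t i y * ln (sol g t i y)))
        * sol g t i x) (at t within {0..})"
      unfolding G_sol[OF t x] unfolding sol_def by (rule tilted_deriv[OF gi x t])
    show "u0 i x / (R i * exp (C i / c))\<^sup>2 \<le> sol g t i x \<and> sol g t i x \<le> (R i * exp (C i / c))\<^sup>2"
      using tilted_ge[OF gi x t] tilted_le[OF gi x t] unfolding sol_def K_def by simp
  next
    fix v k t i x
    assume dens: "\<And>t i. 0 \<le> t \<Longrightarrow> probability_density (M i) (v t i)"
      and init: "\<And>i x. x \<in> space (M i) \<Longrightarrow> v 0 i x = u0 i x"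
      and deriv: "\<And>t i x. 0 \<le> t \<Longrightarrow> x \<in> space (M i) \<Longrightarrow> ((\<lambda>s. v s i x) has_real_derivative
        - (G (v t) i x + c * ln (v t i x) - k i t) * v t i x) (at t within {0..})"
      and k: "\<And>t i. 0 \<le> t \<Longrightarrow> 0 \<le> k i t" and t: "(0::real) \<le> t" and x: "x \<in> space (M i)"
    have cont: "continuous_on {0..} (\<lambda>t. v t j y)" if "y \<in> space (M j)" for j y
      unfolding continuous_on_eq_continuous_within
      using deriv[OF _ that] by (auto intro: DERIV_continuous)
    have adm: "admissible_rate (M j) (C j) (\<lambda>t. G (v t) j)" for j
      by (rule admissible_rate_G[OF dens cont])
    \<comment> \<open>The rates seen by the competitor. Since the competitor must be the tilted
      density of \<open>h\<close>, \<open>h\<close> is itself a fixed point of \<open>T\<close>,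
      hence equal to \<open>g\<close> on \<open>A\<close>.\<close>
    define h where "h = (\<lambda>(i, t, x). G (v t) i x)"
    have hS: "h \<in> S"
      using adm by (simp add: S_def h_def)
    have v_sol: "v t j y = sol h t j y" if "0 \<le> t" "y \<in> space (M j)" for t j y
      unfolding sol_def h_def prod.case
      by (rule eq_tilted[OF adm _ init deriv k _ that(2,1)])
        (use dens in \<open>auto simp: probability_density_def\<close>)
    \<comment> \<open>\<open>v\<close> and \<open>sol h\<close> agree only on the spaces, so they
      need not be equal as functions. Their distance in mean is zero, and \<open>G_lipschitz\<close>
      then identifies the values of \<open>G\<close>.\<close>
    have G_cong: "G v' j y = G w j y" if v': "\<And>j. probability_density (M j) (v' j)"
      and w: "\<And>j. probability_density (M j) (w j)"
      and eq: "\<And>j y. y \<in> space (M j) \<Longrightarrow> v' j y = w j y" and y: "y \<in> space (M j)" for v' w j y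
    proof -
      have "(LINT y|M j. \<bar>v' j y - w j y\<bar>) = (LINT y|M j. 0)" for j
        by (rule Bochner_Integration.integral_cong) (simp_all add: eq)
      then show ?thesis
        using G_lipschitz[OF v' w y] by simp
    qed
    have "T h p = h p" if "p \<in> A" for p
      using that v_sol sol_dens[OF hS] dens
      by (auto simp: A_def T_def h_def intro!: G_cong)
    then have h_g: "h p = g p" if "p \<in> A" for p
      using uniq[OF hS] that by blast
    have "sol h t i x = sol g t i x"
    proof -
      have "tilt c (u0 i) (\<lambda>t x. h (i, t, x)) t y = tilt c (u0 i) (\<lambda>t x. g (i, t, x)) t y"
        if "y \<in> space (M i)" for y
        unfolding tilt_def using that h_g
        by (auto simp: A_def intro!: Henstock_Kurzweil_Integration.integral_cong)
      then show ?thesis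
        using x by (simp add: sol_def tilted_def cong: Bochner_Integration.integral_cong)
    qed
    with v_sol[OF t x] show "v t i x = sol g t i x" by simp
  qed (use sol_dens[OF g] tilted_0[OF gi] in \<open>auto simp: sol_def\<close>)
qed

end

section \<open>Densities with respect to a reference probability measure\<close>

lemma space_measure_of_density [simp]: "space (measure_of_density Z p) = Z"
  by (simp add: measure_of_density_def space_restrict_space)

lemma sets_measure_of_density [simp]:
  "sets (measure_of_density Z p) = sets (restrict_space borel Z)"
  by (simp add: measure_of_density_def cong: sets_restrict_space_cong)

lemma ac_densityD:
  assumes "ac_density Z p"
  shows "prob_space (measure_of_density Z p)"
    and "p \<in> borel_measurable (restrict_space borel Z)" "\<And>x. x \<in> Z \<Longrightarrow> 0 \<le> p x"
  using assms by (auto simp: ac_density_def prob_measures_ac_def prob_measures_def)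

lemma measurable_restrict_space_lborel:
  "borel_measurable (restrict_space lborel Z) = borel_measurable (restrict_space borel Z)"
  by (rule measurable_cong_sets) (simp_all cong: sets_restrict_space_cong)

lemma measure_of_density_cong:
  assumes "p \<in> borel_measurable (restrict_space borel Z)" "q \<in> borel_measurable (restrict_space borel Z)"
    and "\<And>x. x \<in> Z \<Longrightarrow> p x = q x"
  shows "measure_of_density Z p = measure_of_density Z q"
  unfolding measure_of_density_def
  by (rule density_cong)
    (use assms in \<open>auto simp: measurable_restrict_space_lborel space_restrict_space intro!: AE_I2 measurable_compose[OF _ measurable_ennreal]\<close>)

lemma density_measure_of_density:
  assumes p: "p \<in> borel_measurable (restrict_space borel Z)" and p_nonneg: "\<And>x. x \<in> Z \<Longrightarrow> 0 \<le> p x"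
    and v: "v \<in> borel_measurable (restrict_space borel Z)" and v_nonneg: "\<And>x. x \<in> Z \<Longrightarrow> 0 \<le> v x"
  shows "density (measure_of_density Z p) (\<lambda>x. ennreal (v x)) = measure_of_density Z (\<lambda>x. v x * p x)"
proof -
  have [measurable]: "p \<in> borel_measurable (restrict_space lborel Z)" "v \<in> borel_measurable (restrict_space lborel Z)"
    using p v by (simp_all add: measurable_restrict_space_lborel)
  have "density (measure_of_density Z p) (\<lambda>x. ennreal (v x)) =
      density (restrict_space lborel Z) (\<lambda>x. ennreal (p x) * ennreal (v x))"
    unfolding measure_of_density_def by (rule density_density_eq) auto
  also have "\<dots> = measure_of_density Z (\<lambda>x. v x * p x)"
    unfolding measure_of_density_def
    by (rule density_cong)
      (use p_nonneg v_nonneg in \<open>auto intro!: AE_I2 simp: space_restrict_space ennreal_mult mult.commute\<close>)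
  finally show ?thesis .
qed

lemma prob_space_density:
  assumes v: "probability_density M v"
  shows "prob_space (density M (\<lambda>x. ennreal (v x)))"
proof
  have "emeasure (density M (\<lambda>x. ennreal (v x))) (space M) = (\<integral>\<^sup>+x. ennreal (v x) * indicator (space M) x \<partial>M)"
    using v by (intro emeasure_density) (auto simp: probability_density_def)
  also have "\<dots> = (\<integral>\<^sup>+x. ennreal (v x) \<partial>M)"
    by (rule nn_integral_cong) simp
  also have "\<dots> = 1"
    using v by (subst nn_integral_eq_integral) (auto simp: probability_density_def)
  finally show "emeasure (density M (\<lambda>x. ennreal (v x))) (space (density M (\<lambda>x. ennreal (v x)))) = 1"
    by simp
qed

lemma probability_densityI:
  assumes v: "v \<in> borel_measurable M" "\<And>x. x \<in> space M \<Longrightarrow> 0 \<le> v x"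
    and prob: "prob_space (density M (\<lambda>x. ennreal (v x)))"
  shows "probability_density M v"
proof -
  have "1 = emeasure (density M (\<lambda>x. ennreal (v x))) (space M)"
    using prob_space.emeasure_space_1[OF prob] by simp
  also have "\<dots> = (\<integral>\<^sup>+x. ennreal (v x) * indicator (space M) x \<partial>M)"
    using v by (intro emeasure_density) auto
  also have "\<dots> = (\<integral>\<^sup>+x. ennreal (v x) \<partial>M)"
    by (rule nn_integral_cong) simp
  finally have nn: "(\<integral>\<^sup>+x. ennreal (v x) \<partial>M) = ennreal 1" by simp
  have "has_bochner_integral M v 1"
    by (rule has_bochner_integral_nn_integral[OF _ _ _ nn]) (use v in auto)
  then show ?thesis
    using v by (auto simp: probability_density_def has_bochner_integral_iff)
qed

lemma probability_density_measurable:
  assumes "probability_density (measure_of_density Z p) v"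
  shows "v \<in> borel_measurable (restrict_space borel Z)"
proof -
  have "v \<in> borel_measurable (measure_of_density Z p)"
    using assms by (auto simp: probability_density_def)
  then show ?thesis
    by (subst measurable_cong_sets[OF sets_measure_of_density[symmetric] refl])
qed

context
  fixes Z :: "'a::euclidean_space set" and p :: "'a \<Rightarrow> real"
  assumes p: "ac_density Z p"
begin

lemma density_eq_measure_of_density:
  assumes v: "probability_density (measure_of_density Z p) v"
  shows "density (measure_of_density Z p) (\<lambda>x. ennreal (v x)) = measure_of_density Z (\<lambda>x. v x * p x)"
  by (rule density_measure_of_density[OF ac_densityD(2,3)[OF p] probability_density_measurable[OF v]])
    (use v in \<open>auto simp: probability_density_def\<close>)

lemma ac_density_of_probability_density:
  assumes v: "probability_density (measure_of_density Z p) v"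
  shows "ac_density Z (\<lambda>x. v x * p x)"
proof -
  have meas: "(\<lambda>x. v x * p x) \<in> borel_measurable (restrict_space borel Z)"
    by (rule borel_measurable_times[OF probability_density_measurable[OF v] ac_densityD(2)[OF p]])
  have "prob_space (measure_of_density Z (\<lambda>x. v x * p x))"
    using prob_space_density[OF v] unfolding density_eq_measure_of_density[OF v] .
  moreover have "absolutely_continuous (restrict_space lborel Z) (measure_of_density Z (\<lambda>x. v x * p x))"
    unfolding measure_of_density_def using meas
    by (intro absolutely_continuousI_density measurable_compose[OF _ measurable_ennreal])
      (simp add: measurable_restrict_space_lborel)
  ultimately show ?thesis
    using meas v ac_densityD(3)[OF p]
    by (auto simp: ac_density_def prob_measures_ac_def prob_measures_def probability_density_def)
qed

text \<open>Positivity of \<open>p\<close> at every point makes division by \<open>p\<close>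
  reversible pointwise, so flows of Lebesgue densities and of relative densities correspond
  exactly.\<close>

lemma probability_density_of_ac_density:
  assumes p_pos: "\<And>x. x \<in> Z \<Longrightarrow> 0 < p x" and n: "ac_density Z n"
  shows "probability_density (measure_of_density Z p) (\<lambda>x. n x / p x)"
    and "measure_of_density Z (\<lambda>x. n x / p x * p x) = measure_of_density Z n"
proof -
  have meas: "(\<lambda>x. n x / p x) \<in> borel_measurable (restrict_space borel Z)"
    by (rule borel_measurable_divide[OF ac_densityD(2)[OF n] ac_densityD(2)[OF p]])
  have nonneg: "0 \<le> n x / p x" if "x \<in> Z" for x
    using that ac_densityD(3)[OF n] ac_densityD(3)[OF p] by simp
  show eq: "measure_of_density Z (\<lambda>x. n x / p x * p x) = measure_of_density Z n"
    by (rule measure_of_density_cong[OF borel_measurable_times[OF meas ac_densityD(2)[OF p]]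
        ac_densityD(2)[OF n]]) (use p_pos in force)
  show "probability_density (measure_of_density Z p) (\<lambda>x. n x / p x)"
  proof (rule probability_densityI)
    show "(\<lambda>x. n x / p x) \<in> borel_measurable (measure_of_density Z p)"
      using meas by (subst measurable_cong_sets[OF sets_measure_of_density refl])
    show "prob_space (density (measure_of_density Z p) (\<lambda>x. ennreal (n x / p x)))"
      using ac_densityD(1)[OF n] density_measure_of_density[OF ac_densityD(2,3)[OF p] meas nonneg] eq
      by simp
  qed (use nonneg in auto)
qed

end

section \<open>Relative entropy\<close>

lemma (in prob_space) entropy_density_density_AE:
  assumes v: "probability_density M v"
  shows "AE x in M. entropy_density (exp 1) M (density M (\<lambda>x. ennreal (v x))) x = ln (v x)"
proof -
  have "AE x in M. ennreal (v x) = RN_deriv M (density M (\<lambda>x. ennreal (v x))) x"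
    by (rule RN_deriv_unique) (use v in \<open>auto simp: probability_density_def\<close>)
  with AE_space show ?thesis
  proof eventually_elim
    case (elim x)
    then have "enn2real (RN_deriv M (density M (\<lambda>x. ennreal (v x))) x) = v x"
      using v by (simp add: probability_density_def flip: elim(2))
    then show ?case
      by (simp add: entropy_density_def log_ln)
  qed
qed

text \<open>The Radon-Nikodym derivative agrees with \<open>v\<close> only almost everywhere. An
  equivalence is required, since failure of integrability is what makes \<open>KL\<close>
  infinite.\<close>

lemma (in prob_space) integrable_entropy_density_iff:
  assumes v: "probability_density M v"
  shows "integrable (density M (\<lambda>x. ennreal (v x))) (entropy_density (exp 1) M (density M (\<lambda>x. ennreal (v x))))
    \<longleftrightarrow> integrable M (\<lambda>x. v x * ln (v x))"
proof -
  have [measurable]: "v \<in> borel_measurable M"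
    using v by (auto simp: probability_density_def)
  have "integrable (density M (\<lambda>x. ennreal (v x))) (entropy_density (exp 1) M (density M (\<lambda>x. ennreal (v x))))
    \<longleftrightarrow> integrable M (\<lambda>x. v x * entropy_density (exp 1) M (density M (\<lambda>x. ennreal (v x))) x)"
    using v by (subst integrable_real_density) (auto simp: probability_density_def measurable_entropy_density)
  also have "\<dots> \<longleftrightarrow> integrable M (\<lambda>x. v x * ln (v x))"
    using entropy_density_density_AE[OF v]
    by (intro integrable_cong_AE) (auto simp: measurable_entropy_density)
  finally show ?thesis .
qed

lemma (in prob_space) KL_density_eq:
  assumes v: "probability_density M v" and int: "integrable M (\<lambda>x. v x * ln (v x))"
  shows "KL (density M (\<lambda>x. ennreal (v x))) M = ereal (LINT x|M. v x * ln (v x))"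
proof -
  have meas: "v \<in> borel_measurable M" and nonneg: "AE x in M. 0 \<le> v x"
    using v by (auto simp: probability_density_def)
  have "absolutely_continuous M (density M (\<lambda>x. ennreal (v x)))"
    using meas by (intro absolutely_continuousI_density) auto
  moreover have "KL_divergence (exp 1) M (density M (\<lambda>x. ennreal (v x))) = (LINT x|M. v x * ln (v x))"
    using KL_density[OF _ meas nonneg, of "exp 1"] by (simp add: log_ln)
  ultimately show ?thesis
    using int by (simp add: KL_def integrable_entropy_density_iff[OF v])
qed

text \<open>Provides the sign of \<open>k\<close> in the uniqueness argument. In the non-integrable
  case the value is \<infinity> by definition.\<close>

lemma (in prob_space) KL_density_nonneg:
  assumes v: "probability_density M v"
  shows "0 \<le> KL (density M (\<lambda>x. ennreal (v x))) M"
proof (cases "integrable M (\<lambda>x. v x * ln (v x))")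
  case True
  interpret information_space M "exp 1"
    by standard simp
  have "0 \<le> KL_divergence (exp 1) M (density M v)"
    by (rule KL_nonneg)
      (use v True prob_space_density[OF v] in \<open>auto simp: probability_density_def log_ln[symmetric]\<close>)
  then show ?thesis
    by (simp add: KL_def)
next
  case False
  then show ?thesis
    by (simp add: KL_def integrable_entropy_density_iff[OF v])
qed

lemma (in prob_space) integrable_entropy_of_bounded:
  assumes v: "probability_density M v" and le: "\<And>x. x \<in> space M \<Longrightarrow> v x \<le> B"
  shows "integrable M (\<lambda>x. v x * ln (v x))"
proof (rule integrable_const_bound[where B = "1 + B\<^sup>2"])
  have [measurable]: "v \<in> borel_measurable M"
    using v by (auto simp: probability_density_def)
  show "(\<lambda>x. v x * ln (v x)) \<in> borel_measurable M"
    by measurable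
  show "AE x in M. norm (v x * ln (v x)) \<le> 1 + B\<^sup>2"
    using v le abs_mult_ln_le[of "v x" B for x]
    by (intro AE_I2) (simp add: probability_density_def mult.commute)
qed

text \<open>The entropy is the mean of ln v under the probability measure with density
  \<open>v\<close>.\<close>

lemma (in prob_space) entropy_le_of_bounded:
  assumes v: "probability_density M v" and le: "\<And>x. x \<in> space M \<Longrightarrow> v x \<le> B"
  shows "(LINT x|M. v x * ln (v x)) \<le> ln B"
proof -
  have "(LINT x|M. v x * ln (v x)) \<le> (LINT x|M. v x * ln B)"
  proof (rule integral_mono[OF integrable_entropy_of_bounded[OF v le]])
    show "v x * ln (v x) \<le> v x * ln B" if "x \<in> space M" for x
    proof (cases "v x = 0")
      case False
      with v that have "0 < v x" by (force simp: probability_density_def)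
      with le[OF that] show ?thesis by simp
    qed simp
  qed (use v in \<open>auto simp: probability_density_def\<close>)
  also have "\<dots> = ln B"
    using v by (simp add: probability_density_def)
  finally show ?thesis .
qed

section \<open>Lipschitz continuity from bounded flat derivatives\<close>

lemma mixture_in_prob_measures:
  assumes m: "m \<in> prob_measures Z" and m': "m' \<in> prob_measures Z" and \<epsilon>: "0 \<le> \<epsilon>" "\<epsilon> \<le> 1"
  shows "mixture \<epsilon> m m' \<in> prob_measures Z"
proof -
  have sets: "sets m' = sets m" "sets m = sets (restrict_space borel Z)"
    using m m' by (auto simp: prob_measures_def)
  have one: "emeasure m (space m) = 1" "emeasure m' (space m) = 1"
    using m m' sets_eq_imp_space_eq[OF sets(1)]
    by (auto simp: prob_measures_def prob_space.emeasure_space_1 dest: prob_space.emeasure_space_1)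
  have "emeasure (mixture \<epsilon> m m') (space m) =
      ennreal (1 - \<epsilon>) * emeasure m (space m) + ennreal \<epsilon> * emeasure m' (space m)"
  \<comment> \<open>\<open>measure_of\<close> is known to take the prescribed values once these are
    countably additive.\<close>
  proof (rule emeasure_measure_of[OF mixture_def sets.space_closed])
    show "countably_additive (sets (mixture \<epsilon> m m'))
      (\<lambda>A. ennreal (1 - \<epsilon>) * emeasure m A + ennreal \<epsilon> * emeasure m' A)"
    proof (rule countably_additiveI)
      fix A :: "nat \<Rightarrow> 'a set"
      assume A: "range A \<subseteq> sets (mixture \<epsilon> m m')" "disjoint_family A"
      then have "range A \<subseteq> sets m"
        by (simp add: mixture_def)
      then show "(\<Sum>i. ennreal (1 - \<epsilon>) * emeasure m (A i) + ennreal \<epsilon> * emeasure m' (A i)) =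
          ennreal (1 - \<epsilon>) * emeasure m (\<Union> (range A)) + ennreal \<epsilon> * emeasure m' (\<Union> (range A))"
        using A(2) sets(1)
        by (simp add: suminf_add[symmetric] ennreal_suminf_cmult suminf_emeasure)
    qed
  qed (auto simp: positive_def mixture_def)
  also have "\<dots> = 1"
    using \<epsilon> by (simp add: one flip: ennreal_plus)
  finally have "prob_space (mixture \<epsilon> m m')"
    by (intro prob_spaceI) (simp add: mixture_def)
  moreover have "sets (mixture \<epsilon> m m') = sets m"
    by (simp add: mixture_def)
  ultimately show ?thesis
    using sets(2) by (simp add: prob_measures_def)
qed

lemma topspace_weak_topology: "topspace (weak_topology Z) = prob_measures Z"
proof -
  \<comment> \<open>The zero function with \<open>U = UNIV\<close> exhibits the whole set as a
    generator.\<close>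
  have "prob_measures Z \<in> {{m \<in> prob_measures Z. (LINT x|m. f x) \<in> U} |f U.
        continuous_on Z f \<and> bounded (f ` Z) \<and> open (U :: real set)}"
    by (rule CollectI, rule exI[of _ "\<lambda>_. 0"], rule exI[of _ UNIV]) (auto simp: bounded_def)
  then show ?thesis
    unfolding weak_topology_def topology_generated_by_topspace by blast
qed

text \<open>Joint continuity restricts to continuity in the point on each slice of fixed
  measure.\<close>

lemma flat_derivative_measurable:
  assumes D: "has_flat_derivative Z G D" and m: "m \<in> prob_measures Z"
  shows "D m \<in> borel_measurable (restrict_space borel Z)"
proof -
  have "continuous_map (top_of_set Z) euclideanreal ((\<lambda>(m, x). D m x) \<circ> (\<lambda>x. (m, x)))"
    by (rule continuous_map_compose[of _ "prod_topology (weak_topology Z) (top_of_set Z)"])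
      (use D m in \<open>auto simp: has_flat_derivative_def continuous_map_pairwise o_def topspace_weak_topology\<close>)
  then have "continuous_on Z (D m)"
    by (simp add: o_def continuous_map_iff_continuous)
  then show ?thesis
    by (rule borel_measurable_continuous_on_restrict)
qed

text \<open>On the segment joining the two measures, which stays among the probability measures, the
  integrand in the definition is the integral of a function bounded by \<open>C\<close> against w -
  v. Applied to second-order derivatives, this makes the first-order ones Lipschitz in mean.\<close>

lemma flat_derivative_lipschitz:
  assumes D: "has_flat_derivative Z G D"
    and bound: "\<And>m x. m \<in> prob_measures Z \<Longrightarrow> x \<in> Z \<Longrightarrow> \<bar>D m x\<bar> \<le> C"
    and M: "sets M = sets (restrict_space borel Z)"
    and v: "probability_density M v" and w: "probability_density M w"
  shows "\<bar>G (density M (\<lambda>x. ennreal (w x))) - G (density M (\<lambda>x. ennreal (v x)))\<bar>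
    \<le> C * (LINT x|M. \<bar>v x - w x\<bar>)"
proof -
  let ?m = "density M (\<lambda>x. ennreal (v x))" and ?m' = "density M (\<lambda>x. ennreal (w x))"
  define I where "I \<epsilon> = (LINT x|?m'. D (mixture \<epsilon> ?m ?m') x) - (LINT x|?m. D (mixture \<epsilon> ?m ?m') x)" for \<epsilon>
  have space_M: "space M = Z"
    using sets_eq_imp_space_eq[OF M] by (simp add: space_restrict_space)
  have m: "?m \<in> prob_measures Z" "?m' \<in> prob_measures Z"
    using prob_space_density[OF v] prob_space_density[OF w] M by (auto simp: prob_measures_def)
  have G: "set_integrable lborel {0..1} I" "G ?m' - G ?m = (LINT \<epsilon>:{0..1}|lborel. I \<epsilon>)"
    using D m unfolding has_flat_derivative_def Let_def I_def by blast+
  have I: "\<bar>I \<epsilon>\<bar> \<le> C * (LINT x|M. \<bar>v x - w x\<bar>)" if \<epsilon>: "\<epsilon> \<in> {0..1}" for \<epsilon>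
  proof -
    define f where "f = D (mixture \<epsilon> ?m ?m')"
    have mix: "mixture \<epsilon> ?m ?m' \<in> prob_measures Z"
      using mixture_in_prob_measures[OF m] \<epsilon> by simp
    have f_meas: "f \<in> borel_measurable M"
      using flat_derivative_measurable[OF D mix] unfolding f_def
      by (subst measurable_cong_sets[OF M refl])
    have f_bound: "\<bar>f x\<bar> \<le> C" if "x \<in> space M" for x
      using bound[OF mix] that by (simp add: f_def space_M)
    have dens: "integrable M (\<lambda>x. u x * f x) \<and> (LINT x|density M (\<lambda>x. ennreal (u x)). f x) = (LINT x|M. u x * f x)"
      if u: "probability_density M u" for u
    proof
      show "integrable M (\<lambda>x. u x * f x)"
      proof (rule Bochner_Integration.integrable_bound)
        show "integrable M (\<lambda>x. C * u x)"
          using u by (simp add: probability_density_def)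
        show "AE x in M. norm (u x * f x) \<le> norm (C * u x)"
        proof (rule AE_I2)
          fix x assume x: "x \<in> space M"
          then have ux: "0 \<le> u x"
            using u by (simp add: probability_density_def)
          have "\<bar>f x\<bar> * u x \<le> \<bar>C\<bar> * u x"
            using f_bound[OF x] ux by (intro mult_right_mono) auto
          then show "norm (u x * f x) \<le> norm (C * u x)"
            using ux by (simp add: abs_mult mult.commute)
        qed
      qed (use u f_meas in \<open>auto simp: probability_density_def\<close>)
      show "(LINT x|density M (\<lambda>x. ennreal (u x)). f x) = (LINT x|M. u x * f x)"
        by (rule integral_real_density) (use u f_meas in \<open>auto simp: probability_density_def\<close>)
    qed
    have "I \<epsilon> = (LINT x|M. w x * f x - v x * f x)"
      using dens[OF v] dens[OF w] by (simp add: I_def f_def)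
    also have "\<bar>\<dots>\<bar> \<le> (LINT x|M. \<bar>w x * f x - v x * f x\<bar>)"
      by (rule integral_abs_bound)
    also have "\<dots> \<le> (LINT x|M. C * \<bar>v x - w x\<bar>)"
    proof (rule integral_mono)
      show "\<bar>w x * f x - v x * f x\<bar> \<le> C * \<bar>v x - w x\<bar>" if "x \<in> space M" for x
      proof -
        have "w x * f x - v x * f x = f x * (w x - v x)"
          by (simp add: algebra_simps)
        then have "\<bar>w x * f x - v x * f x\<bar> = \<bar>f x\<bar> * \<bar>v x - w x\<bar>"
          by (simp only: abs_mult abs_minus_commute)
        also have "\<dots> \<le> C * \<bar>v x - w x\<bar>"
          using f_bound[OF that] by (rule mult_right_mono) simp
        finally show ?thesis .
      qed
    qed (use dens[OF v] dens[OF w] v w in \<open>auto simp: probability_density_def\<close>)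
    finally show ?thesis by simp
  qed
  have "\<bar>LINT \<epsilon>:{0..1}|lborel. I \<epsilon>\<bar> \<le> (LINT \<epsilon>:{0..1}|lborel. \<bar>I \<epsilon>\<bar>)"
    using set_integral_norm_bound[OF G(1)] by simp
  also have "\<dots> \<le> (LINT \<epsilon>:{0..1::real}|lborel. C * (LINT x|M. \<bar>v x - w x\<bar>))"
    by (rule set_integral_mono[OF set_integrable_abs[OF G(1)] _ I]) (simp add: set_integrable_def)
  also have "\<dots> = C * (LINT x|M. \<bar>v x - w x\<bar>)"
    by (simp add: set_lebesgue_integral_def)
  finally show ?thesis using G(2) by simp
qed

section \<open>The coupled flow as a system with two components\<close>

theorem theorem2p2:
  fixes X Y :: "(real ^ 'd) set"
    and U\<pi> U\<rho> \<pi> \<rho> \<nu>0 \<mu>0 :: "real ^ 'd \<Rightarrow> real"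
    and F :: "(real ^ 'd) measure \<Rightarrow> (real ^ 'd) measure \<Rightarrow> real"
    and D\<nu> D\<mu> :: "(real ^ 'd) measure \<Rightarrow> (real ^ 'd) measure \<Rightarrow> real ^ 'd \<Rightarrow> real"
    and D\<nu>\<nu> D\<mu>\<mu> D\<nu>\<mu> D\<mu>\<nu> ::
      "(real ^ 'd) measure \<Rightarrow> (real ^ 'd) measure \<Rightarrow> real ^ 'd \<Rightarrow> real ^ 'd \<Rightarrow> real"
    and \<sigma> C\<nu> C\<mu> C\<nu>\<nu> C\<mu>\<mu> C\<nu>\<mu> C\<mu>\<nu> R\<nu> R\<mu> :: real
  assumes X: "X \<in> sets borel" and Y: "Y \<in> sets borel"
    and U\<pi>: "U\<pi> \<in> borel_measurable (restrict_space borel X)"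
    and U\<rho>: "U\<rho> \<in> borel_measurable (restrict_space borel Y)"
    and \<pi>: "ac_density X \<pi>" "\<exists>c>0. \<forall>x\<in>X. \<pi> x = c * exp (- U\<pi> x)"
    and \<rho>: "ac_density Y \<rho>" "\<exists>c>0. \<forall>y\<in>Y. \<rho> y = c * exp (- U\<rho> y)"
    and \<sigma>: "\<sigma> > 0"
    and D\<nu>: "\<And>\<mu>. \<mu> \<in> prob_measures Y \<Longrightarrow>
        has_flat_derivative X (\<lambda>\<nu>. F \<nu> \<mu>) (\<lambda>\<nu> x. D\<nu> \<nu> \<mu> x)"
    and D\<mu>: "\<And>\<nu>. \<nu> \<in> prob_measures X \<Longrightarrow>
        has_flat_derivative Y (\<lambda>\<mu>. F \<nu> \<mu>) (\<lambda>\<mu> y. D\<mu> \<nu> \<mu> y)"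
    and C1: "C\<nu> > 0" "C\<mu> > 0"
    and D1_bound: "\<And>\<nu> \<mu> x y. \<lbrakk>\<nu> \<in> prob_measures X; \<mu> \<in> prob_measures Y; x \<in> X; y \<in> Y\<rbrakk> \<Longrightarrow>
        \<bar>D\<nu> \<nu> \<mu> x\<bar> \<le> C\<nu> \<and> \<bar>D\<mu> \<nu> \<mu> y\<bar> \<le> C\<mu>"
    and D\<nu>\<nu>: "\<And>\<mu> x. \<lbrakk>\<mu> \<in> prob_measures Y; x \<in> X\<rbrakk> \<Longrightarrow>
        has_flat_derivative X (\<lambda>\<nu>. D\<nu> \<nu> \<mu> x) (\<lambda>\<nu> x'. D\<nu>\<nu> \<nu> \<mu> x x')"
    and D\<mu>\<mu>: "\<And>\<nu> y. \<lbrakk>\<nu> \<in> prob_measures X; y \<in> Y\<rbrakk> \<Longrightarrow>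
        has_flat_derivative Y (\<lambda>\<mu>. D\<mu> \<nu> \<mu> y) (\<lambda>\<mu> y'. D\<mu>\<mu> \<nu> \<mu> y y')"
    and D\<nu>\<mu>: "\<And>\<mu> y. \<lbrakk>\<mu> \<in> prob_measures Y; y \<in> Y\<rbrakk> \<Longrightarrow>
        has_flat_derivative X (\<lambda>\<nu>. D\<mu> \<nu> \<mu> y) (\<lambda>\<nu> x. D\<nu>\<mu> \<nu> \<mu> y x)"
    and D\<mu>\<nu>: "\<And>\<nu> x. \<lbrakk>\<nu> \<in> prob_measures X; x \<in> X\<rbrakk> \<Longrightarrow>
        has_flat_derivative Y (\<lambda>\<mu>. D\<nu> \<nu> \<mu> x) (\<lambda>\<mu> y. D\<mu>\<nu> \<nu> \<mu> x y)"
    and C2: "C\<nu>\<nu> > 0" "C\<mu>\<mu> > 0" "C\<nu>\<mu> > 0" "C\<mu>\<nu> > 0"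
    and D2_bound: "\<And>\<nu> \<mu> x x' y y'.
        \<lbrakk>\<nu> \<in> prob_measures X; \<mu> \<in> prob_measures Y; x \<in> X; x' \<in> X; y \<in> Y; y' \<in> Y\<rbrakk> \<Longrightarrow>
        \<bar>D\<nu>\<nu> \<nu> \<mu> x x'\<bar> \<le> C\<nu>\<nu> \<and> \<bar>D\<mu>\<mu> \<nu> \<mu> y y'\<bar> \<le> C\<mu>\<mu> \<and>
        \<bar>D\<nu>\<mu> \<nu> \<mu> y x\<bar> \<le> C\<nu>\<mu> \<and> \<bar>D\<mu>\<nu> \<nu> \<mu> x y\<bar> \<le> C\<mu>\<nu>"
    and \<nu>0: "ac_density X \<nu>0"
      "absolutely_continuous (measure_of_density X \<pi>) (measure_of_density X \<nu>0)"
    and \<mu>0: "ac_density Y \<mu>0"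
      "absolutely_continuous (measure_of_density Y \<rho>) (measure_of_density Y \<mu>0)"
    and R: "R\<nu> > 1" "R\<mu> > 1"
    and sup0: "(SUP x\<in>X. ereal (\<nu>0 x / \<pi> x)) \<le> ereal R\<nu>"
      "(SUP y\<in>Y. ereal (\<mu>0 y / \<rho> y)) \<le> ereal R\<mu>"
  shows "\<exists>\<nu> \<mu>. is_flow X Y \<sigma> D\<nu> D\<mu> \<pi> \<rho> \<nu>0 \<mu>0 \<nu> \<mu> \<and>
    (\<forall>\<nu>' \<mu>'. is_flow X Y \<sigma> D\<nu> D\<mu> \<pi> \<rho> \<nu>0 \<mu>0 \<nu>' \<mu>' \<longrightarrow>
       (\<forall>t\<ge>0. (\<forall>x\<in>X. \<nu>' t x = \<nu> t x) \<and> (\<forall>y\<in>Y. \<mu>' t y = \<mu> t y))) \<and>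
    (\<forall>t>0. KL (measure_of_density X (\<nu> t)) (measure_of_density X \<pi>)
             \<le> ereal (2 * ln R\<nu> + 4 / \<sigma>\<^sup>2 * C\<nu>) \<and>
           KL (measure_of_density Y (\<mu> t)) (measure_of_density Y \<rho>)
             \<le> ereal (2 * ln R\<mu> + 4 / \<sigma>\<^sup>2 * C\<mu>)) \<and>
    (\<exists>R1\<nu>>1. \<exists>R1\<mu>>1. \<forall>t>0.
       (SUP x\<in>X. ereal (\<nu> t x / \<pi> x)) \<le> ereal R1\<nu> \<and>
       (SUP y\<in>Y. ereal (\<mu> t y / \<rho> y)) \<le> ereal R1\<mu>) \<and>
    ((\<exists>r\<nu>>0. \<exists>r\<mu>>0. ereal r\<nu> \<le> (INF x\<in>X. ereal (\<nu>0 x / \<pi> x)) \<and>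
                    ereal r\<mu> \<le> (INF y\<in>Y. ereal (\<mu>0 y / \<rho> y))) \<longrightarrow>
     (\<exists>r1\<nu>>0. \<exists>r1\<mu>>0. \<forall>t>0.
       ereal r1\<nu> \<le> (INF x\<in>X. ereal (\<nu> t x / \<pi> x)) \<and>
       ereal r1\<mu> \<le> (INF y\<in>Y. ereal (\<mu> t y / \<rho> y))))"
proof -
  define c where "c = \<sigma>\<^sup>2 / 2"
  have c: "0 < c"
    using \<sigma> by (simp add: c_def)
  have \<pi>_pos: "0 < \<pi> x" if "x \<in> X" for x
    using \<pi>(2) that by force
  have \<rho>_pos: "0 < \<rho> y" if "y \<in> Y" for y
    using \<rho>(2) that by force
  define P Q where "P = measure_of_density X \<pi>" and "Q = measure_of_density Y \<rho>"
  interpret P: prob_space P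
    unfolding P_def by (rule ac_densityD(1)[OF \<pi>(1)])
  interpret Q: prob_space Q
    unfolding Q_def by (rule ac_densityD(1)[OF \<rho>(1)])
  have space_P: "space P = X" and sets_P: "sets P = sets (restrict_space borel X)"
    and space_Q: "space Q = Y" and sets_Q: "sets Q = sets (restrict_space borel Y)"
    by (simp_all add: P_def Q_def)
  \<comment> \<open>The derivative bounds quantify over points of both sets at once, so using one of
    them takes a point of the other set; both carry a probability measure and are nonempty.\<close>
  obtain x0 y0 where x0: "x0 \<in> X" and y0: "y0 \<in> Y"
    using P.not_empty Q.not_empty by (auto simp: space_P space_Q)

  define M where "M i = (if i then P else Q)" for i
  define C where "C i = (if i then C\<nu> else C\<mu>)" for i
  define R where "R i = (if i then R\<nu> else R\<mu>)" for i
  define u0 where "u0 i x = (if i then \<nu>0 x / \<pi> x else \<mu>0 x / \<rho> x)" for i x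
  define N\<nu> where "N\<nu> v = density P (\<lambda>x. ennreal (v True x))" for v :: "bool \<Rightarrow> real ^ 'd \<Rightarrow> real"
  define N\<mu> where "N\<mu> v = density Q (\<lambda>y. ennreal (v False y))" for v :: "bool \<Rightarrow> real ^ 'd \<Rightarrow> real"
  define G where "G v i x = (if i then D\<nu> (N\<nu> v) (N\<mu> v) x else - D\<mu> (N\<nu> v) (N\<mu> v) x)" for v i x
  define L where "L = C\<nu>\<nu> + C\<mu>\<mu> + C\<nu>\<mu> + C\<mu>\<nu>"

  have dens: "probability_density P (v True)" "probability_density Q (v False)"
    if "\<And>j. probability_density (M j) (v j)" for v
    using that[of True] that[of False] by (simp_all add: M_def)
  have N_in: "N\<nu> v \<in> prob_measures X" "N\<mu> v \<in> prob_measures Y"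
    if "\<And>j. probability_density (M j) (v j)" for v
    using prob_space_density[OF dens(1)[OF that]] prob_space_density[OF dens(2)[OF that]]
    by (simp_all add: N\<nu>_def N\<mu>_def prob_measures_def sets_P sets_Q)
  have u0_dens: "probability_density P (u0 True)" "probability_density Q (u0 False)"
    using probability_density_of_ac_density(1)[OF \<pi>(1) \<pi>_pos \<nu>0(1)]
      probability_density_of_ac_density(1)[OF \<rho>(1) \<rho>_pos \<mu>0(1)]
    by (simp_all add: P_def Q_def u0_def[abs_def])
  have u0_le: "u0 True x \<le> R\<nu>" if "x \<in> X" for x
    using order_trans[OF SUP_upper[OF that] sup0(1)] by (simp add: u0_def)
  have u0_le': "u0 False y \<le> R\<mu>" if "y \<in> Y" for y
    using order_trans[OF SUP_upper[OF that] sup0(2)] by (simp add: u0_def)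

  interpret S: tilting_system M c C R u0 G L
  proof (rule tilting_system.intro)
    fix i
    show "tilting (M i) c (C i) (R i) (u0 i)"
    proof (cases i)
      case True
      show ?thesis
        using u0_dens(1) u0_le C1 R c P.prob_space_axioms
        unfolding tilting_def tilting_axioms_def probability_density_def
        by (auto simp: True M_def C_def R_def space_P)
    next
      case False
      show ?thesis
        using u0_dens(2) u0_le' C1 R c Q.prob_space_axioms
        unfolding tilting_def tilting_axioms_def probability_density_def
        by (auto simp: False M_def C_def R_def space_Q)
    qed
  next
    fix v i assume v: "\<And>j. probability_density (M j) (v j)"
    have "D\<nu> (N\<nu> v) (N\<mu> v) \<in> borel_measurable P"
      using flat_derivative_measurable[OF D\<nu>[OF N_in(2)[OF v]] N_in(1)[OF v]]
      by (subst measurable_cong_sets[OF sets_P refl])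
    moreover have "D\<mu> (N\<nu> v) (N\<mu> v) \<in> borel_measurable Q"
      using flat_derivative_measurable[OF D\<mu>[OF N_in(1)[OF v]] N_in(2)[OF v]]
      by (subst measurable_cong_sets[OF sets_Q refl])
    ultimately have meas: "D\<nu> (N\<nu> v) (N\<mu> v) \<in> borel_measurable P" "D\<mu> (N\<nu> v) (N\<mu> v) \<in> borel_measurable Q" .
    then show "G v i \<in> borel_measurable (M i)"
      by (cases i) (simp_all add: G_def[abs_def] M_def)
    \<comment> \<open>Centring of \<open>G\<close> is the convention fixing the additive constant of
      a flat derivative, rewritten as an integral against the reference measure.\<close>
    have "(LINT x|P. v True x * D\<nu> (N\<nu> v) (N\<mu> v) x) = (LINT x|N\<nu> v. D\<nu> (N\<nu> v) (N\<mu> v) x)"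
      unfolding N\<nu>_def
      by (rule integral_real_density[symmetric])
        (use meas dens[OF v] in \<open>auto simp: probability_density_def N\<nu>_def\<close>)
    also have "\<dots> = 0"
      using D\<nu>[OF N_in(2)[OF v]] N_in(1)[OF v] by (simp add: has_flat_derivative_def)
    finally have 1: "(LINT x|P. v True x * D\<nu> (N\<nu> v) (N\<mu> v) x) = 0" .
    have "(LINT y|Q. v False y * D\<mu> (N\<nu> v) (N\<mu> v) y) = (LINT y|N\<mu> v. D\<mu> (N\<nu> v) (N\<mu> v) y)"
      unfolding N\<mu>_def
      by (rule integral_real_density[symmetric])
        (use meas dens[OF v] in \<open>auto simp: probability_density_def N\<mu>_def\<close>)
    also have "\<dots> = 0"
      using D\<mu>[OF N_in(1)[OF v]] N_in(2)[OF v] by (simp add: has_flat_derivative_def)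
    finally have 2: "(LINT y|Q. v False y * D\<mu> (N\<nu> v) (N\<mu> v) y) = 0" .
    show "(LINT x|M i. G v i x * v i x) = 0"
      using 1 2 by (cases i) (simp_all add: G_def M_def mult.commute)
    show "\<bar>G v i x\<bar> \<le> C i" if "x \<in> space (M i)" for x
      using D1_bound[OF N_in[OF v], of x y0] D1_bound[OF N_in[OF v], of x0 x] x0 y0 that
      by (cases i) (simp_all add: G_def C_def M_def space_P space_Q)
  next
    show "0 \<le> L"
      using C2 by (simp add: L_def)
  next
    fix v w i x
    assume v: "\<And>j. probability_density (M j) (v j)" and w: "\<And>j. probability_density (M j) (w j)"
      and x: "x \<in> space (M i)"
    define dP dQ where "dP = (LINT x|P. \<bar>v True x - w True x\<bar>)"
      and "dQ = (LINT y|Q. \<bar>v False y - w False y\<bar>)"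
    have d0: "0 \<le> dP" "0 \<le> dQ"
      by (simp_all add: dP_def dQ_def)
    have dP': "(LINT x|P. \<bar>w True x - v True x\<bar>) = dP" and dQ': "(LINT y|Q. \<bar>w False y - v False y\<bar>) = dQ"
      by (simp_all add: dP_def dQ_def abs_minus_commute)
    note N_v = N_in[OF v] and N_w = N_in[OF w]
    have "\<bar>G v i x - G w i x\<bar> \<le> L * (dP + dQ)"
    proof (cases i)
      case True
      with x have x: "x \<in> X" by (simp add: M_def space_P)
      \<comment> \<open>The measures are changed one at a time, since each second-order derivative
        varies one argument with the other fixed.\<close>
      have "\<bar>D\<nu> (N\<nu> v) (N\<mu> v) x - D\<nu> (N\<nu> w) (N\<mu> v) x\<bar> \<le> C\<nu>\<nu> * dP"
        using flat_derivative_lipschitz[OF D\<nu>\<nu>[OF N_v(2) x] _ sets_P dens(1)[OF w] dens(1)[OF v], of C\<nu>\<nu>]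
          D2_bound[OF _ N_v(2) x _ y0 y0] by (simp add: N\<nu>_def dP')
      moreover have "\<bar>D\<nu> (N\<nu> w) (N\<mu> v) x - D\<nu> (N\<nu> w) (N\<mu> w) x\<bar> \<le> C\<mu>\<nu> * dQ"
        using flat_derivative_lipschitz[OF D\<mu>\<nu>[OF N_w(1) x] _ sets_Q dens(2)[OF w] dens(2)[OF v], of C\<mu>\<nu>]
          D2_bound[OF N_w(1) _ x x _ y0] by (simp add: N\<mu>_def dQ')
      moreover have "C\<nu>\<nu> * dP \<le> L * dP" "C\<mu>\<nu> * dQ \<le> L * dQ"
        using C2 d0 by (auto intro!: mult_right_mono simp: L_def)
      ultimately show ?thesis
        using True by (simp add: G_def distrib_left)
    next
      case False
      with x have x: "x \<in> Y" by (simp add: M_def space_Q)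
      have "\<bar>D\<mu> (N\<nu> v) (N\<mu> v) x - D\<mu> (N\<nu> w) (N\<mu> v) x\<bar> \<le> C\<nu>\<mu> * dP"
        using flat_derivative_lipschitz[OF D\<nu>\<mu>[OF N_v(2) x] _ sets_P dens(1)[OF w] dens(1)[OF v], of C\<nu>\<mu>]
          D2_bound[OF _ N_v(2) _ x0 x x] by (simp add: N\<nu>_def dP')
      moreover have "\<bar>D\<mu> (N\<nu> w) (N\<mu> v) x - D\<mu> (N\<nu> w) (N\<mu> w) x\<bar> \<le> C\<mu>\<mu> * dQ"
        using flat_derivative_lipschitz[OF D\<mu>\<mu>[OF N_w(1) x] _ sets_Q dens(2)[OF w] dens(2)[OF v], of C\<mu>\<mu>]
          D2_bound[OF N_w(1) _ x0 x0 x] by (simp add: N\<mu>_def dQ')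
      moreover have "C\<nu>\<mu> * dP \<le> L * dP" "C\<mu>\<mu> * dQ \<le> L * dQ"
        using C2 d0 by (auto intro!: mult_right_mono simp: L_def)
      ultimately show ?thesis
        using False by (simp add: G_def distrib_left)
    qed
    then show "\<bar>G v i x - G w i x\<bar> \<le> L * (\<Sum>j\<in>UNIV. LINT y|M j. \<bar>v j y - w j y\<bar>)"
      by (simp add: UNIV_bool M_def dP_def dQ_def add.commute)
  qed

  obtain u :: "real \<Rightarrow> bool \<Rightarrow> real ^ 'd \<Rightarrow> real"
    where u_dens: "\<And>t i. 0 \<le> t \<Longrightarrow> probability_density (M i) (u t i)"
    and u_init: "\<And>i x. x \<in> space (M i) \<Longrightarrow> u 0 i x = u0 i x"
    and u_deriv: "\<And>t i x. 0 \<le> t \<Longrightarrow> x \<in> space (M i) \<Longrightarrow> ((\<lambda>s. u s i x) has_real_derivative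
      - (G (u t) i x + c * ln (u t i x) - c * (LINT y|M i. u t i y * ln (u t i y))) * u t i x)
      (at t within {0..})"
    and u_bounds: "\<And>t i x. 0 \<le> t \<Longrightarrow> x \<in> space (M i) \<Longrightarrow>
      u0 i x / (R i * exp (C i / c))\<^sup>2 \<le> u t i x \<and> u t i x \<le> (R i * exp (C i / c))\<^sup>2"
    and u_unique: "\<And>v k t i x. \<lbrakk>\<And>t i. 0 \<le> t \<Longrightarrow> probability_density (M i) (v t i);
      \<And>i x. x \<in> space (M i) \<Longrightarrow> v 0 i x = u0 i x;
      \<And>t i x. 0 \<le> t \<Longrightarrow> x \<in> space (M i) \<Longrightarrow> ((\<lambda>s. v s i x) has_real_derivative
        - (G (v t) i x + c * ln (v t i x) - k i t) * v t i x) (at t within {0..});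
      \<And>t i. 0 \<le> t \<Longrightarrow> 0 \<le> k i t; 0 \<le> t; x \<in> space (M i)\<rbrakk> \<Longrightarrow> v t i x = u t i x"
    by (rule S.exists_unique_flow) blast
  have dens_P: "probability_density P (u t True)" and dens_Q: "probability_density Q (u t False)"
    if "0 \<le> t" for t
    using u_dens[OF that, of True] u_dens[OF that, of False] by (simp_all add: M_def)

  define K\<nu> K\<mu> where "K\<nu> = (R\<nu> * exp (C\<nu> / c))\<^sup>2" and "K\<mu> = (R\<mu> * exp (C\<mu> / c))\<^sup>2"
  have bounds_P: "\<nu>0 x / \<pi> x / K\<nu> \<le> u t True x" "u t True x \<le> K\<nu>" if "0 \<le> t" "x \<in> X" for t x
    using u_bounds[of t x True] that by (simp_all add: M_def R_def C_def K\<nu>_def u0_def space_P)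
  have bounds_Q: "\<mu>0 y / \<rho> y / K\<mu> \<le> u t False y" "u t False y \<le> K\<mu>" if "0 \<le> t" "y \<in> Y" for t y
    using u_bounds[of t y False] that by (simp_all add: M_def R_def C_def K\<mu>_def u0_def space_Q)
  have K_gt_1: "1 < (r * exp (d / c))\<^sup>2" if "1 < r" "0 < d" for r d :: real
  proof -
    have "1 * 1 < r * exp (d / c)"
      using that c by (intro mult_strict_mono) auto
    then show ?thesis by (simp add: one_less_power)
  qed
  have K: "1 < K\<nu>" "1 < K\<mu>"
    using K_gt_1 R C1 by (simp_all add: K\<nu>_def K\<mu>_def)
  \<comment> \<open>With c = \<open>\<sigma>\<^sup>2 / 2\<close>, the exponent 2 C / c becomes 4 C /
    \<open>\<sigma>\<^sup>2\<close>: the entropy bound is the logarithm of the density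
    bound.\<close>
  have ln_K: "ln K\<nu> = 2 * ln R\<nu> + 4 / \<sigma>\<^sup>2 * C\<nu>" "ln K\<mu> = 2 * ln R\<mu> + 4 / \<sigma>\<^sup>2 * C\<mu>"
    using R by (simp_all add: K\<nu>_def K\<mu>_def ln_realpow ln_mult c_def)

  define \<nu> where "\<nu> t x = u t True x * \<pi> x" for t x
  define \<mu> where "\<mu> t y = u t False y * \<rho> y" for t y
  have \<nu>_div: "\<nu> t x / \<pi> x = u t True x" if "x \<in> X" for t x
    using \<pi>_pos[OF that] by (simp add: \<nu>_def)
  have \<mu>_div: "\<mu> t y / \<rho> y = u t False y" if "y \<in> Y" for t y
    using \<rho>_pos[OF that] by (simp add: \<mu>_def)
  have \<nu>_meas: "measure_of_density X (\<nu> t) = N\<nu> (u t)"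
    and \<mu>_meas: "measure_of_density Y (\<mu> t) = N\<mu> (u t)" if t: "0 \<le> t" for t
    using density_eq_measure_of_density[OF \<pi>(1) dens_P[OF t, unfolded P_def]]
      density_eq_measure_of_density[OF \<rho>(1) dens_Q[OF t, unfolded Q_def]]
    by (simp_all add: N\<nu>_def N\<mu>_def \<nu>_def[abs_def] \<mu>_def[abs_def] P_def Q_def)
  have KL_\<nu>: "KL (N\<nu> (u t)) P = ereal (LINT x|P. u t True x * ln (u t True x))"
    and KL_\<mu>: "KL (N\<mu> (u t)) Q = ereal (LINT y|Q. u t False y * ln (u t False y))" if t: "0 \<le> t" for t
    unfolding N\<nu>_def N\<mu>_def
    by (rule P.KL_density_eq[OF dens_P[OF t] P.integrable_entropy_of_bounded[OF dens_P[OF t] bounds_P(2)[OF t]]]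
        Q.KL_density_eq[OF dens_Q[OF t] Q.integrable_entropy_of_bounded[OF dens_Q[OF t] bounds_Q(2)[OF t]]];
        simp add: space_P space_Q)+

  have deriv_\<nu>: "((\<lambda>s. \<nu> s x) has_real_derivative - rate_a X Y \<sigma> D\<nu> \<pi> (\<nu> t) (\<mu> t) x * \<nu> t x) (at t within {0..})"
    if t: "0 \<le> t" and x: "x \<in> X" for t x
  proof -
    have "((\<lambda>s. u s True x * \<pi> x) has_real_derivative
      - (G (u t) True x + c * ln (u t True x) - c * (LINT y|P. u t True y * ln (u t True y))) * u t True x * \<pi> x)
      (at t within {0..})"
      using u_deriv[OF t, of x True] x by (intro DERIV_cmult_right) (simp add: M_def space_P)
    moreover have "rate_a X Y \<sigma> D\<nu> \<pi> (\<nu> t) (\<mu> t) x =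
        G (u t) True x + c * ln (u t True x) - c * (LINT y|P. u t True y * ln (u t True y))"
      unfolding rate_a_def \<nu>_meas[OF t] \<mu>_meas[OF t] \<nu>_div[OF x] P_def[symmetric] KL_\<nu>[OF t]
      by (simp add: G_def c_def)
    ultimately show ?thesis
      by (simp add: \<nu>_def mult.assoc)
  qed
  have deriv_\<mu>: "((\<lambda>s. \<mu> s y) has_real_derivative rate_b X Y \<sigma> D\<mu> \<rho> (\<nu> t) (\<mu> t) y * \<mu> t y) (at t within {0..})"
    if t: "0 \<le> t" and y: "y \<in> Y" for t y
  proof -
    have "((\<lambda>s. u s False y * \<rho> y) has_real_derivative
      - (G (u t) False y + c * ln (u t False y) - c * (LINT y|Q. u t False y * ln (u t False y))) * u t False y * \<rho> y)
      (at t within {0..})"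
      using u_deriv[OF t, of y False] y by (intro DERIV_cmult_right) (simp add: M_def space_Q)
    moreover have "rate_b X Y \<sigma> D\<mu> \<rho> (\<nu> t) (\<mu> t) y =
        - (G (u t) False y + c * ln (u t False y) - c * (LINT y|Q. u t False y * ln (u t False y)))"
      unfolding rate_b_def \<nu>_meas[OF t] \<mu>_meas[OF t] \<mu>_div[OF y] Q_def[symmetric] KL_\<mu>[OF t]
      by (simp add: G_def c_def)
    ultimately show ?thesis
      by (simp add: \<mu>_def mult.assoc)
  qed

  have flow: "is_flow X Y \<sigma> D\<nu> D\<mu> \<pi> \<rho> \<nu>0 \<mu>0 \<nu> \<mu>"
    unfolding is_flow_def
  proof (intro conjI allI ballI impI)
    fix t :: real assume t: "0 \<le> t"
    show "ac_density X (\<nu> t)" "ac_density Y (\<mu> t)"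
      using ac_density_of_probability_density[OF \<pi>(1) dens_P[OF t, unfolded P_def]]
        ac_density_of_probability_density[OF \<rho>(1) dens_Q[OF t, unfolded Q_def]]
      by (simp_all add: \<nu>_def[abs_def] \<mu>_def[abs_def])
    show "KL (measure_of_density X (\<nu> t)) (measure_of_density X \<pi>) < \<infinity>"
      "KL (measure_of_density Y (\<mu> t)) (measure_of_density Y \<rho>) < \<infinity>"
      unfolding \<nu>_meas[OF t] \<mu>_meas[OF t] P_def[symmetric] Q_def[symmetric] KL_\<nu>[OF t] KL_\<mu>[OF t]
      by simp_all
  next
    fix x assume x: "x \<in> X"
    show "\<nu> 0 x = \<nu>0 x"
      using u_init[of x True] x \<pi>_pos[OF x] by (simp add: \<nu>_def M_def space_P u0_def)
    show "continuous_on {0..} (\<lambda>t. \<nu> t x)"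
      unfolding continuous_on_eq_continuous_within
      using deriv_\<nu>[OF _ x] by (auto intro: DERIV_continuous)
  next
    fix y assume y: "y \<in> Y"
    show "\<mu> 0 y = \<mu>0 y"
      using u_init[of y False] y \<rho>_pos[OF y] by (simp add: \<mu>_def M_def space_Q u0_def)
    show "continuous_on {0..} (\<lambda>t. \<mu> t y)"
      unfolding continuous_on_eq_continuous_within
      using deriv_\<mu>[OF _ y] by (auto intro: DERIV_continuous)
  qed (use deriv_\<nu> deriv_\<mu> in blast)+
  have unique: "(\<forall>x\<in>X. \<nu>' t x = \<nu> t x) \<and> (\<forall>y\<in>Y. \<mu>' t y = \<mu> t y)"
    if flow: "is_flow X Y \<sigma> D\<nu> D\<mu> \<pi> \<rho> \<nu>0 \<mu>0 \<nu>' \<mu>'" and t: "0 \<le> t" for \<nu>' \<mu>' t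
  proof -
    have ac: "ac_density X (\<nu>' t)" "ac_density Y (\<mu>' t)" if "0 \<le> t" for t
      using flow that by (auto simp: is_flow_def)
    have init: "\<And>x. x \<in> X \<Longrightarrow> \<nu>' 0 x = \<nu>0 x" "\<And>y. y \<in> Y \<Longrightarrow> \<mu>' 0 y = \<mu>0 y"
      using flow by (auto simp: is_flow_def)
    have deriv: "\<And>t x. 0 \<le> t \<Longrightarrow> x \<in> X \<Longrightarrow> ((\<lambda>s. \<nu>' s x) has_real_derivative
         - rate_a X Y \<sigma> D\<nu> \<pi> (\<nu>' t) (\<mu>' t) x * \<nu>' t x) (at t within {0..})"
       "\<And>t y. 0 \<le> t \<Longrightarrow> y \<in> Y \<Longrightarrow> ((\<lambda>s. \<mu>' s y) has_real_derivative
         rate_b X Y \<sigma> D\<mu> \<rho> (\<nu>' t) (\<mu>' t) y * \<mu>' t y) (at t within {0..})"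
      using flow by (auto simp: is_flow_def)
    define v where "v t i x = (if i then \<nu>' t x / \<pi> x else \<mu>' t x / \<rho> x)" for t i x
    \<comment> \<open>The competitor's own entropy term; finiteness from \<open>is_flow\<close> is
      not involved in its sign, which follows from nonnegativity of the extended value.\<close>
    define k where "k i t = c * real_of_ereal
      (if i then KL (measure_of_density X (\<nu>' t)) P else KL (measure_of_density Y (\<mu>' t)) Q)" for i t
    have v_dens: "probability_density (M i) (v t i)" if "0 \<le> t" for t i
      using probability_density_of_ac_density(1)[OF \<pi>(1) \<pi>_pos ac(1)[OF that]]
        probability_density_of_ac_density(1)[OF \<rho>(1) \<rho>_pos ac(2)[OF that]]
      by (cases i) (simp_all add: v_def[abs_def] M_def P_def Q_def)
    have N_v: "N\<nu> (v t) = measure_of_density X (\<nu>' t)" "N\<mu> (v t) = measure_of_density Y (\<mu>' t)"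
      if t: "0 \<le> t" for t
      using density_eq_measure_of_density[OF \<pi>(1) probability_density_of_ac_density(1)[OF \<pi>(1) \<pi>_pos ac(1)[OF t]]]
        density_eq_measure_of_density[OF \<rho>(1) probability_density_of_ac_density(1)[OF \<rho>(1) \<rho>_pos ac(2)[OF t]]]
        probability_density_of_ac_density(2)[OF \<pi>(1) \<pi>_pos ac(1)[OF t]]
        probability_density_of_ac_density(2)[OF \<rho>(1) \<rho>_pos ac(2)[OF t]]
      by (simp_all add: N\<nu>_def N\<mu>_def v_def P_def Q_def)
    have "v t i x = u t i x" if x: "x \<in> space (M i)" for i x
    proof (rule u_unique[of v k, OF v_dens _ _ _ t x])
      show "v 0 i x = u0 i x" if "x \<in> space (M i)" for i x
        using that init by (cases i) (simp_all add: v_def u0_def M_def space_P space_Q)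
    next
      fix t :: real and i assume t: "0 \<le> t"
      have "0 \<le> KL (N\<nu> (v t)) P" "0 \<le> KL (N\<mu> (v t)) Q"
        unfolding N\<nu>_def N\<mu>_def
        using P.KL_density_nonneg Q.KL_density_nonneg dens[OF v_dens[OF t]] by auto
      then show "0 \<le> k i t"
        using c by (simp add: k_def N_v[OF t] real_of_ereal_pos)
    next
      fix t :: real and i x assume t: "0 \<le> t" and x: "x \<in> space (M i)"
      show "((\<lambda>s. v s i x) has_real_derivative - (G (v t) i x + c * ln (v t i x) - k i t) * v t i x)
        (at t within {0..})"
      proof (cases i)
        case True
        with x have x: "x \<in> X" by (simp add: M_def space_P)
        have "rate_a X Y \<sigma> D\<nu> \<pi> (\<nu>' t) (\<mu>' t) x = G (v t) i x + c * ln (v t i x) - k i t"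
          by (simp add: rate_a_def G_def N_v[OF t] k_def c_def v_def P_def True)
        then show ?thesis
          using DERIV_cdivide[OF deriv(1)[OF t x], of "\<pi> x"] by (simp add: v_def True)
      next
        case False
        with x have x: "x \<in> Y" by (simp add: M_def space_Q)
        have "rate_b X Y \<sigma> D\<mu> \<rho> (\<nu>' t) (\<mu>' t) x = - (G (v t) i x + c * ln (v t i x) - k i t)"
          by (simp add: rate_b_def G_def N_v[OF t] k_def c_def v_def Q_def False)
        then show ?thesis
          using DERIV_cdivide[OF deriv(2)[OF t x], of "\<rho> x"] by (simp add: v_def False)
      qed
    qed
    from this[of _ True] this[of _ False] show ?thesis
      using \<pi>_pos \<rho>_pos by (force simp: M_def space_P space_Q v_def \<nu>_def \<mu>_def field_simps)
  qed
  have KL_le: "KL (measure_of_density X (\<nu> t)) (measure_of_density X \<pi>) \<le> ereal (2 * ln R\<nu> + 4 / \<sigma>\<^sup>2 * C\<nu>)"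
    "KL (measure_of_density Y (\<mu> t)) (measure_of_density Y \<rho>) \<le> ereal (2 * ln R\<mu> + 4 / \<sigma>\<^sup>2 * C\<mu>)"
    if t: "0 < t" for t
    unfolding ln_K[symmetric]
    using P.entropy_le_of_bounded[OF dens_P, of t K\<nu>] Q.entropy_le_of_bounded[OF dens_Q, of t K\<mu>]
      bounds_P(2)[of t] bounds_Q(2)[of t] t
    by (simp_all add: \<nu>_meas \<mu>_meas P_def[symmetric] Q_def[symmetric] KL_\<nu> KL_\<mu> space_P space_Q)
  have upper: "\<exists>R1\<nu>>1. \<exists>R1\<mu>>1. \<forall>t>0.
       (SUP x\<in>X. ereal (\<nu> t x / \<pi> x)) \<le> ereal R1\<nu> \<and>
       (SUP y\<in>Y. ereal (\<mu> t y / \<rho> y)) \<le> ereal R1\<mu>"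
  proof -
    have "\<forall>t>0. (SUP x\<in>X. ereal (\<nu> t x / \<pi> x)) \<le> ereal K\<nu> \<and>
        (SUP y\<in>Y. ereal (\<mu> t y / \<rho> y)) \<le> ereal K\<mu>"
      using bounds_P(2) bounds_Q(2) \<nu>_div \<mu>_div by (auto intro!: SUP_least)
    with K show ?thesis by blast
  qed
  have lower: "\<exists>r1\<nu>>0. \<exists>r1\<mu>>0. \<forall>t>0.
       ereal r1\<nu> \<le> (INF x\<in>X. ereal (\<nu> t x / \<pi> x)) \<and>
       ereal r1\<mu> \<le> (INF y\<in>Y. ereal (\<mu> t y / \<rho> y))"
    if r: "0 < r\<nu>" "0 < r\<mu>" "ereal r\<nu> \<le> (INF x\<in>X. ereal (\<nu>0 x / \<pi> x))"
      "ereal r\<mu> \<le> (INF y\<in>Y. ereal (\<mu>0 y / \<rho> y))" for r\<nu> r\<mu>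
  proof -
    \<comment> \<open>The lower bound on a normalised tilt is proportional to the initial relative
      density, so a positive infimum persists up to the factor \<open>K\<nu>\<close>.\<close>
    have r\<nu>: "r\<nu> / K\<nu> \<le> \<nu> t x / \<pi> x" if "0 < t" "x \<in> X" for t x
    proof -
      have "r\<nu> \<le> \<nu>0 x / \<pi> x"
        using order_trans[OF r(3) INF_lower[OF that(2)]] by simp
      then have "r\<nu> / K\<nu> \<le> \<nu>0 x / \<pi> x / K\<nu>"
        using K by (intro divide_right_mono) auto
      also have "\<dots> \<le> \<nu> t x / \<pi> x"
        using bounds_P(1)[of t x] that by (simp add: \<nu>_div)
      finally show ?thesis .
    qed
    have r\<mu>: "r\<mu> / K\<mu> \<le> \<mu> t y / \<rho> y" if "0 < t" "y \<in> Y" for t y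
    proof -
      have "r\<mu> \<le> \<mu>0 y / \<rho> y"
        using order_trans[OF r(4) INF_lower[OF that(2)]] by simp
      then have "r\<mu> / K\<mu> \<le> \<mu>0 y / \<rho> y / K\<mu>"
        using K by (intro divide_right_mono) auto
      also have "\<dots> \<le> \<mu> t y / \<rho> y"
        using bounds_Q(1)[of t y] that by (simp add: \<mu>_div)
      finally show ?thesis .
    qed
    have "\<forall>t>0. ereal (r\<nu> / K\<nu>) \<le> (INF x\<in>X. ereal (\<nu> t x / \<pi> x)) \<and>
        ereal (r\<mu> / K\<mu>) \<le> (INF y\<in>Y. ereal (\<mu> t y / \<rho> y))"
      using r\<nu> r\<mu> by (auto intro!: INF_greatest)
    moreover have "0 < r\<nu> / K\<nu>" "0 < r\<mu> / K\<mu>"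
      using K r(1,2) by auto
    ultimately show ?thesis by blast
  qed
  show ?thesis
    by (rule exI[of _ \<nu>], rule exI[of _ \<mu>], intro conjI)
      (rule flow, use unique in blast, use KL_le in blast, rule upper, use lower in blast)
qed

end
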